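(* Let $K$ be a field of characteristic $p>0$, $\delta:K\to K$ a derivation, and $F=\{a\in K : \delta(a)=0\}$. Suppose $\delta$ is algebraic over $F$ with minimum polynomial $g(t)=t^p-t\in F[t]$. Then for every $f(t)=t^p-t-d\in K[t;\delta]$ with $d\in K\setminus F$, the algebra $(K,\delta,d)=S_f=K[t;\delta]/K[t;\delta]f(t)$ is a unital nonassociative division algebra over $F$ of dimension $p^2$. Its left nucleus and its middle nucleus are both equal to $K$, its right nucleus contains $K$, and its automorphism group contains a cyclic subgroup of order $p$ which leaves $K$ invariant.
   Context: $K[t;\delta]$ is the differential polynomial ring: polynomials $\sum a_it^i$ with left coefficients $a_i\in K$, termwise addition, and multiplication determined by $ta=at+\delta(a)$ for $a\in K$. It has right division: for all $h,f$ with $f\neq 0$ there are unique $q,r$ with $h=qf+r$ and $\deg r<\deg f$; write $r=h \bmod_r f$. For monic $f\in K[t;\delta]$ of degree $m\ge 2$, the Petit algebra $S_f=K[t;\delta]/K[t;\delta]f$ is the $F$-vector space $\{h\in K[t;\delta] : \deg h<m\}$ with multiplication $h\circ k = hk \bmod_r f$; it is a unital, not necessarily associative $F$-algebra containing $K$ (as the constant polynomials). For a nonassociative algebra $A$ with associator $[x,y,z]=(xy)z-x(yz)$: ${\rm Nuc}_l(A)=\{x : [x,A,A]=0\}$, ${\rm Nuc}_m(A)=\{x : [A,x,A]=0\}$, ${\rm Nuc}_r(A)=\{x : [A,A,x]=0\}$ are the left, middle and right nucleus. $A\ne 0$ is a division algebra if for each $a\neq 0$ left and right multiplication by $a$ are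 bijective. *)

theory Defs
  imports
    "HOL-Computational_Algebra.Polynomial"
    "HOL-Algebra.Bij"
    "HOL-Algebra.Elementary_Groups"
    "Jordan_Normal_Form.Missing_VectorSpace"
begin

section \<open>Derivations, constants, minimum polynomials\<close>

definition derivation :: "('a::field \<Rightarrow> 'a) \<Rightarrow> bool" where
  "derivation \<delta> \<longleftrightarrow>
     (\<forall>a b. \<delta> (a + b) = \<delta> a + \<delta> b) \<and> (\<forall>a b. \<delta> (a * b) = a * \<delta> b + \<delta> a * b)"

definition constants :: "('a::field \<Rightarrow> 'a) \<Rightarrow> 'a set" where
  "constants \<delta> = {a. \<delta> a = 0}"

definition constant_field :: "('a::field \<Rightarrow> 'a) \<Rightarrow> 'a ring" where
  "constant_field \<delta> = \<lparr>carrier = constants \<delta>, mult = (*), one = 1, zero = 0, add = (+)\<rparr>"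

text \<open>The operator \<open>g(\<delta>) = \<Sum>i. g\<^sub>i \<delta>\<^sup>i\<close> on \<open>K\<close>.\<close>

definition poly_of_map :: "('a::field \<Rightarrow> 'a) \<Rightarrow> 'a poly \<Rightarrow> 'a \<Rightarrow> 'a" where
  "poly_of_map \<delta> g x = (\<Sum>i\<le>degree g. coeff g i * (\<delta> ^^ i) x)"

definition is_minimum_polynomial :: "('a::field \<Rightarrow> 'a) \<Rightarrow> 'a poly \<Rightarrow> bool" where
  "is_minimum_polynomial \<delta> g \<longleftrightarrow>
     lead_coeff g = 1 \<and> (\<forall>i. coeff g i \<in> constants \<delta>) \<and> (\<forall>x. poly_of_map \<delta> g x = 0) \<and>
     (\<forall>h. h \<noteq> 0 \<and> (\<forall>i. coeff h i \<in> constants \<delta>) \<and> (\<forall>x. poly_of_map \<delta> h x = 0)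
        \<longrightarrow> degree g \<le> degree h)"


section \<open>The differential polynomial ring\<close>

text \<open>Elements of \<open>K[t;\<delta>]\<close> are the polynomials \<open>\<Sum>i. a\<^sub>i t\<^sup>i\<close> with left coefficients, so the
  additive group of \<open>K[t;\<delta>]\<close> is that of \<^typ>\<open>'a poly\<close>; the commutative product of
  \<^typ>\<open>'a poly\<close> is not used. The rule \<open>t a = a t + \<delta>(a)\<close> makes left multiplication by \<open>t\<close> the map
  \<open>\<Sum>j. b\<^sub>j t\<^sup>j \<mapsto> \<Sum>j. b\<^sub>j t\<^sup>j\<^sup>+\<^sup>1 + \<Sum>j. \<delta>(b\<^sub>j) t\<^sup>j\<close>.\<close>

definition t_mult :: "('a::field \<Rightarrow> 'a) \<Rightarrow> 'a poly \<Rightarrow> 'a poly" where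
  "t_mult \<delta> k = pCons 0 k + map_poly \<delta> k"

definition dmult :: "('a::field \<Rightarrow> 'a) \<Rightarrow> 'a poly \<Rightarrow> 'a poly \<Rightarrow> 'a poly" where
  "dmult \<delta> h k = (\<Sum>i\<le>degree h. Polynomial.smult (coeff h i) ((t_mult \<delta> ^^ i) k))"

lemma dmult_const_left: "dmult \<delta> [:a:] k = Polynomial.smult a k"
  by (simp add: dmult_def)

lemma dmult_t_const:
  assumes "derivation \<delta>"
  shows "dmult \<delta> [:0, 1:] [:a:] = dmult \<delta> [:a:] [:0, 1:] + [:\<delta> a:]"
proof -
  have "\<delta> 0 = 0"
    using assms unfolding derivation_def by (metis add_cancel_right_right)
  then show ?thesis
    by (simp add: dmult_def t_mult_def map_poly_pCons)
qed

text \<open>Since \<open>degree 0 = 0\<close> in the library, \<open>r = 0\<close> has to be admitted separately to obtain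
  \<open>deg r < deg f\<close> with \<open>deg 0 = -\<infinity>\<close>.\<close>

definition mod_r :: "('a::field \<Rightarrow> 'a) \<Rightarrow> 'a poly \<Rightarrow> 'a poly \<Rightarrow> 'a poly" where
  "mod_r \<delta> h f = (THE r. (\<exists>q. h = dmult \<delta> q f + r) \<and> (r = 0 \<or> degree r < degree f))"


section \<open>Nonassociative algebras\<close>

text \<open>Algebras are presented as module records, whose multiplication is not assumed to be
  associative.\<close>

locale unital_algebra = vectorspace F A for F and A (structure) +
  assumes mult_closed: "\<lbrakk>x \<in> carrier A; y \<in> carrier A\<rbrakk> \<Longrightarrow> x \<otimes> y \<in> carrier A"
    and distrib_right: "\<lbrakk>x \<in> carrier A; y \<in> carrier A; z \<in> carrier A\<rbrakk>
          \<Longrightarrow> (x \<oplus> y) \<otimes> z = x \<otimes> z \<oplus> y \<otimes> z"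
    and distrib_left: "\<lbrakk>x \<in> carrier A; y \<in> carrier A; z \<in> carrier A\<rbrakk>
          \<Longrightarrow> x \<otimes> (y \<oplus> z) = x \<otimes> y \<oplus> x \<otimes> z"
    and scalar_left: "\<lbrakk>c \<in> carrier F; x \<in> carrier A; y \<in> carrier A\<rbrakk>
          \<Longrightarrow> (c \<odot> x) \<otimes> y = c \<odot> (x \<otimes> y)"
    and scalar_right: "\<lbrakk>c \<in> carrier F; x \<in> carrier A; y \<in> carrier A\<rbrakk>
          \<Longrightarrow> x \<otimes> (c \<odot> y) = c \<odot> (x \<otimes> y)"
    and unit_closed: "\<one> \<in> carrier A"
    and unit_left: "x \<in> carrier A \<Longrightarrow> \<one> \<otimes> x = x"
    and unit_right: "x \<in> carrier A \<Longrightarrow> x \<otimes> \<one> = x"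

locale unital_division_algebra = unital_algebra +
  assumes nonzero: "carrier A \<noteq> {\<zero>}"
    and left_mult_bij: "\<lbrakk>a \<in> carrier A; a \<noteq> \<zero>\<rbrakk>
          \<Longrightarrow> bij_betw (\<lambda>x. a \<otimes> x) (carrier A) (carrier A)"
    and right_mult_bij: "\<lbrakk>a \<in> carrier A; a \<noteq> \<zero>\<rbrakk>
          \<Longrightarrow> bij_betw (\<lambda>x. x \<otimes> a) (carrier A) (carrier A)"

definition associator :: "('a, 'b) ring_scheme \<Rightarrow> 'a \<Rightarrow> 'a \<Rightarrow> 'a \<Rightarrow> 'a" where
  "associator A x y z = ((x \<otimes>\<^bsub>A\<^esub> y) \<otimes>\<^bsub>A\<^esub> z) \<ominus>\<^bsub>A\<^esub> (x \<otimes>\<^bsub>A\<^esub> (y \<otimes>\<^bsub>A\<^esub> z))"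

definition left_nucleus :: "('a, 'b) ring_scheme \<Rightarrow> 'a set" where
  "left_nucleus A =
     {x \<in> carrier A. \<forall>y \<in> carrier A. \<forall>z \<in> carrier A. associator A x y z = \<zero>\<^bsub>A\<^esub>}"

definition middle_nucleus :: "('a, 'b) ring_scheme \<Rightarrow> 'a set" where
  "middle_nucleus A =
     {y \<in> carrier A. \<forall>x \<in> carrier A. \<forall>z \<in> carrier A. associator A x y z = \<zero>\<^bsub>A\<^esub>}"

definition right_nucleus :: "('a, 'b) ring_scheme \<Rightarrow> 'a set" where
  "right_nucleus A =
     {z \<in> carrier A. \<forall>x \<in> carrier A. \<forall>y \<in> carrier A. associator A x y z = \<zero>\<^bsub>A\<^esub>}"

definition algebra_auto :: "('f, 'c) ring_scheme \<Rightarrow> ('f, 'a, 'b) module_scheme \<Rightarrow> ('a \<Rightarrow> 'a) set"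
  where
  "algebra_auto F A =
     {\<phi> \<in> Bij (carrier A) \<inter> module_hom F A A.
        \<forall>x \<in> carrier A. \<forall>y \<in> carrier A. \<phi> (x \<otimes>\<^bsub>A\<^esub> y) = \<phi> x \<otimes>\<^bsub>A\<^esub> \<phi> y}"

definition Algebra_AutoGroup ::
    "('f, 'c) ring_scheme \<Rightarrow> ('f, 'a, 'b) module_scheme \<Rightarrow> ('a \<Rightarrow> 'a) monoid" where
  "Algebra_AutoGroup F A = BijGroup (carrier A) \<lparr>carrier := algebra_auto F A\<rparr>"


section \<open>Petit algebras\<close>

text \<open>For \<open>degree f \<ge> 1\<close> the carrier contains \<open>0\<close>, so \<open>degree h < degree f\<close> needs no special case.
  The scalar operation is left multiplication by constant polynomials.\<close>

definition petit_algebra :: "('a::field \<Rightarrow> 'a) \<Rightarrow> 'a poly \<Rightarrow> ('a, 'a poly) module" where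
  "petit_algebra \<delta> f =
     \<lparr>carrier = {h. degree h < degree f},
      mult = (\<lambda>h k. mod_r \<delta> (dmult \<delta> h k) f),
      one = 1, zero = 0, add = (+),
      smult = Polynomial.smult\<rparr>"

definition constant_polys :: "'a::field poly set" where
  "constant_polys = range (\<lambda>a. [:a:])"

end

theory Submission
  imports
    "HOL-Algebra.Multiplicative_Group"
    "HOL-Computational_Algebra.Primes"
    Defs
begin

text \<open>
  Write \<open>R = K[t;\<delta>]\<close>. In characteristic \<open>p\<close> the identity \<open>\<delta>\<^sup>p = \<delta>\<close> makes \<open>c = t\<^sup>p - t\<close> central
  in \<open>R\<close>, so that \<open>f z = z f + (z d - d z)\<close> for \<open>f = c - d\<close> and all \<open>z\<close>.

  If \<open>g\<close> is a right divisor of \<open>f\<close>, then \<open>g d - d g = f g - g f\<close> lies in \<open>R g\<close> and has degree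
  less than \<open>m = deg g\<close>, so it vanishes; but its coefficient at \<open>t\<^sup>m\<^sup>-\<^sup>1\<close> is \<open>m \<delta>(d)\<close> times the
  leading coefficient of \<open>g\<close>. Hence \<open>p\<close> divides \<open>m\<close>, and \<open>f\<close> is irreducible. The Euclidean
  algorithm turns irreducibility into the absence of zero divisors in \<open>S\<^sub>f\<close>.

  The field \<open>K\<close> is an \<open>R\<close>-module on which \<open>t\<close> acts as \<open>\<delta>\<close>. The minimality of \<open>t\<^sup>p - t\<close> yields
  \<open>u \<noteq> 0\<close> with \<open>\<delta>(u) = u\<close>. The powers \<open>u\<^sup>i\<close>, \<open>i < p\<close>, are eigenvectors of \<open>\<delta>\<close> for the \<open>p\<close>
  distinct roots of \<open>t\<^sup>p - t\<close> in the prime field, hence an \<open>F\<close>-basis of \<open>K\<close>, and the \<open>u\<^sup>i t\<^sup>j\<close>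
  are an \<open>F\<close>-basis of \<open>S\<^sub>f\<close>. Multiplications by nonzero elements, being injective and
  \<open>F\<close>-linear, are therefore bijective.

  If \<open>q\<close> is the right quotient of \<open>x y\<close> by \<open>f\<close>, then \<open>[x,y,z]\<close> is the remainder of
  \<open>- q f z\<close>. This vanishes if \<open>q = 0\<close> or \<open>f z \<in> R f\<close>, and it does not if
  \<open>deg x + deg y = deg f\<close> and \<open>f z \<notin> R f\<close>, as for \<open>z = t\<close>. Finally, the substitution
  \<open>t \<mapsto> t + 1\<close> is a ring automorphism of \<open>R\<close> that fixes \<open>K\<close> and \<open>f\<close>.
\<close>


section \<open>Finite-dimensional nonassociative algebras\<close>

context vectorspace
begin

lemma lin_indpt_image_if_inj:
  assumes T: "T \<in> module_hom K V V" and inj: "inj_on T (carrier V)"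
    and B: "finite B" "B \<subseteq> carrier V" "lin_indpt B"
  shows "lin_indpt (T ` B)"
proof -
  interpret T: linear_map K V V T
    using T by unfold_locales
  show ?thesis
  proof (rule finite_lin_indpt2)
    fix a assume a: "a \<in> T ` B \<rightarrow> carrier K" and zero: "lincomb a (T ` B) = \<zero>\<^bsub>V\<^esub>"
    have coeffs: "a \<circ> T \<in> B \<rightarrow> carrier K"
      using a by auto
    have "T (lincomb (a \<circ> T) B) = T \<zero>\<^bsub>V\<^esub>"
      by (simp add: zero flip: T.lincomb_linear_image[OF inj B(2) a B(1)])
    then have "lincomb (a \<circ> T) B = \<zero>\<^bsub>V\<^esub>"
      using inj_onD[OF inj] lincomb_closed[OF B(2) coeffs] by blast
    then have "a \<circ> T \<in> B \<rightarrow> {\<zero>\<^bsub>K\<^esub>}"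
      using not_lindepD[OF B(3,1) order.refl coeffs] by simp
    then show "\<forall>v\<in>T ` B. a v = \<zero>\<^bsub>K\<^esub>"
      by auto
  qed (use B in auto)
qed

lemma bij_betw_if_inj_endomorphism:
  assumes fin_dim and T: "T \<in> module_hom K V V" and inj: "inj_on T (carrier V)"
  shows "bij_betw T (carrier V) (carrier V)"
proof -
  interpret T: linear_map K V V T
    using T by unfold_locales
  obtain B where B: "finite B" "basis B"
    using finite_basis_exists \<open>fin_dim\<close> by blast
  then have sub: "B \<subseteq> carrier V" and indpt: "lin_indpt B"
    by (auto simp: basis_def)
  then have sub_image: "T ` B \<subseteq> carrier V"
    by auto
  have "card (T ` B) = dim"
    using dim_basis[OF B] card_image[OF inj_on_subset[OF inj sub]] by simp
  then have "basis (T ` B)"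
    using dim_li_is_basis \<open>fin_dim\<close> B(1) sub_image
      lin_indpt_image_if_inj[OF T inj B(1) sub indpt]
    by simp
  then have "carrier V \<subseteq> span (T ` B)"
    by (simp add: basis_def)
  also have "\<dots> \<subseteq> T ` carrier V"
  proof
    fix v assume "v \<in> span (T ` B)"
    then obtain a where a: "a \<in> T ` B \<rightarrow> carrier K" "v = lincomb a (T ` B)"
      using B(1) sub_image by (auto simp: finite_span)
    then have "v = T (lincomb (a \<circ> T) B)"
      using T.lincomb_linear_image[OF inj sub a(1) B(1)] by simp
    moreover have "lincomb (a \<circ> T) B \<in> carrier V"
      using a(1) by (intro lincomb_closed[OF sub]) auto
    ultimately show "v \<in> T ` carrier V"
      by blast
  qed
  finally show ?thesis
    using inj by (auto simp: bij_betw_def)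
qed

lemma bij_betw_if_trivial_kernel:
  assumes fin_dim and T: "T \<in> module_hom K V V"
    and kernel: "\<And>v. v \<in> carrier V \<Longrightarrow> T v = \<zero>\<^bsub>V\<^esub> \<Longrightarrow> v = \<zero>\<^bsub>V\<^esub>"
  shows "bij_betw T (carrier V) (carrier V)"
proof -
  interpret T: linear_map K V V T
    using T by unfold_locales
  have "inj_on T (carrier V)"
    by (rule T.Ke0_imp_inj) (use kernel in \<open>auto simp: T.ker_def\<close>)
  then show ?thesis
    using bij_betw_if_inj_endomorphism assms by blast
qed

definition lin_indpt_family :: "'i set \<Rightarrow> ('i \<Rightarrow> 'c) \<Rightarrow> bool" where
  "lin_indpt_family I b \<longleftrightarrow>
     (\<forall>a\<in>I \<rightarrow> carrier K. (\<Oplus>\<^bsub>V\<^esub>i\<in>I. a i \<odot>\<^bsub>V\<^esub> b i) = \<zero>\<^bsub>V\<^esub> \<longrightarrow> (\<forall>i\<in>I. a i = \<zero>\<^bsub>K\<^esub>))"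

definition spanning_family :: "'i set \<Rightarrow> ('i \<Rightarrow> 'c) \<Rightarrow> bool" where
  "spanning_family I b \<longleftrightarrow>
     (\<forall>v\<in>carrier V. \<exists>a\<in>I \<rightarrow> carrier K. v = (\<Oplus>\<^bsub>V\<^esub>i\<in>I. a i \<odot>\<^bsub>V\<^esub> b i))"

lemma inj_on_if_lin_indpt_family:
  assumes "finite I" "b \<in> I \<rightarrow> carrier V" "lin_indpt_family I b"
  shows "inj_on b I"
proof (rule inj_onI, rule ccontr)
  fix i j assume ij: "i \<in> I" "j \<in> I" "b i = b j" "i \<noteq> j"
  define a where "a = (\<lambda>_. \<zero>\<^bsub>K\<^esub>)(i := \<one>\<^bsub>K\<^esub>, j := \<ominus>\<^bsub>K\<^esub> \<one>\<^bsub>K\<^esub>)"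
  have coeffs: "a \<in> I \<rightarrow> carrier K"
    by (auto simp: a_def)
  then have closed: "(\<lambda>k. a k \<odot>\<^bsub>V\<^esub> b k) \<in> S \<rightarrow> carrier V" if "S \<subseteq> I" for S
    using assms(2) that by auto
  have "(\<Oplus>\<^bsub>V\<^esub>k\<in>I. a k \<odot>\<^bsub>V\<^esub> b k) = (\<Oplus>\<^bsub>V\<^esub>k\<in>{i, j}. a k \<odot>\<^bsub>V\<^esub> b k)"
    using ij assms(1,2) closed
    by (intro add.finprod_mono_neutral_cong_right) (auto simp: a_def Pi_iff)
  also have "\<dots> = b i \<ominus>\<^bsub>V\<^esub> b j"
    using ij assms(2) by (simp add: a_def smult_l_minus minus_eq Pi_iff)
  also have "\<dots> = \<zero>\<^bsub>V\<^esub>"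
    using ij assms(2) by (simp add: Pi_iff)
  finally have "\<forall>i\<in>I. a i = \<zero>\<^bsub>K\<^esub>"
    using assms(3) coeffs by (simp add: lin_indpt_family_def)
  then have "\<one>\<^bsub>K\<^esub> = \<zero>\<^bsub>K\<^esub>"
    using ij by (auto simp: a_def split: if_splits)
  then show False
    by simp
qed

lemma dim_if_basis_family:
  assumes "finite I" and b: "b \<in> I \<rightarrow> carrier V"
    and indpt: "lin_indpt_family I b" and spanning: "spanning_family I b"
  shows fin_dim and "dim = card I"
proof -
  have inj: "inj_on b I"
    using inj_on_if_lin_indpt_family assms by blast
  have fin: "finite (b ` I)" and sub: "b ` I \<subseteq> carrier V"
    using assms(1,2) by auto
  have lincomb: "lincomb a (b ` I) = (\<Oplus>\<^bsub>V\<^esub>i\<in>I. a (b i) \<odot>\<^bsub>V\<^esub> b i)" if "a \<in> b ` I \<rightarrow> carrier K" for a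
    unfolding lincomb_def using that b by (intro add.finprod_reindex inj) auto
  have "lin_indpt (b ` I)"
  proof (rule finite_lin_indpt2[OF fin sub])
    fix a assume a: "a \<in> b ` I \<rightarrow> carrier K" and "lincomb a (b ` I) = \<zero>\<^bsub>V\<^esub>"
    moreover have "a \<circ> b \<in> I \<rightarrow> carrier K"
      using a by auto
    ultimately have "\<forall>i\<in>I. (a \<circ> b) i = \<zero>\<^bsub>K\<^esub>"
      using indpt unfolding lin_indpt_family_def by (simp add: lincomb)
    then show "\<forall>v\<in>b ` I. a v = \<zero>\<^bsub>K\<^esub>"
      by simp
  qed
  moreover have "v \<in> span (b ` I)" if "v \<in> carrier V" for v
  proof -
    obtain a where a: "a \<in> I \<rightarrow> carrier K" "v = (\<Oplus>\<^bsub>V\<^esub>i\<in>I. a i \<odot>\<^bsub>V\<^esub> b i)"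
      using spanning \<open>v \<in> carrier V\<close> unfolding spanning_family_def by blast
    let ?a = "a \<circ> the_inv_into I b"
    have coeffs: "?a \<in> b ` I \<rightarrow> carrier K"
      using a(1) by (auto simp: the_inv_into_f_f[OF inj])
    have "v = lincomb ?a (b ` I)"
      unfolding a(2) lincomb[OF coeffs] using a(1) b
      by (intro finsum_cong') (auto simp: the_inv_into_f_f[OF inj] Pi_iff)
    then show ?thesis
      using coeffs by (auto simp: finite_span[OF fin sub])
  qed
  ultimately have basis: "basis (b ` I)"
    using sub span_is_subset2[OF sub] by (auto simp: basis_def)
  then show fin_dim
    using fin by (auto simp: fin_dim_def basis_def)
  show "dim = card I"
    using dim_basis[OF fin basis] card_image[OF inj] by simp
qed

end

context unital_algebra
begin

lemma unital_division_algebra_if_no_zero_divisors: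
  assumes fin_dim and "\<one> \<noteq> \<zero>"
    and no_zero_divisors: "\<And>x y. x \<in> carrier A \<Longrightarrow> y \<in> carrier A \<Longrightarrow> x \<otimes> y = \<zero> \<Longrightarrow> x = \<zero> \<or> y = \<zero>"
  shows "unital_division_algebra F A"
proof
  show "carrier A \<noteq> {\<zero>}"
    using unit_closed \<open>\<one> \<noteq> \<zero>\<close> by blast
next
  fix a assume a: "a \<in> carrier A" "a \<noteq> \<zero>"
  show "bij_betw (\<lambda>x. a \<otimes> x) (carrier A) (carrier A)"
    using \<open>fin_dim\<close>
  proof (rule bij_betw_if_trivial_kernel)
    show "(\<lambda>x. a \<otimes> x) \<in> module_hom F A A"
      using a by (auto simp: module_hom_def mult_closed distrib_left scalar_right)
  qed (use a no_zero_divisors in blast)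
  show "bij_betw (\<lambda>x. x \<otimes> a) (carrier A) (carrier A)"
    using \<open>fin_dim\<close>
  proof (rule bij_betw_if_trivial_kernel)
    show "(\<lambda>x. x \<otimes> a) \<in> module_hom F A A"
      using a by (auto simp: module_hom_def mult_closed distrib_right scalar_left)
  qed (use a no_zero_divisors in blast)
qed

lemma subgroup_algebra_auto: "subgroup (algebra_auto F A) (BijGroup (carrier A))"
proof
  show "algebra_auto F A \<subseteq> carrier (BijGroup (carrier A))"
    by (auto simp: algebra_auto_def BijGroup_def)
next
  fix \<phi> \<psi> assume "\<phi> \<in> algebra_auto F A" "\<psi> \<in> algebra_auto F A"
  then show "\<phi> \<otimes>\<^bsub>BijGroup (carrier A)\<^esub> \<psi> \<in> algebra_auto F A"
    by (auto simp: algebra_auto_def BijGroup_def compose_Bij module_hom_def compose_eq mult_closed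
        Pi_iff)
next
  show "\<one>\<^bsub>BijGroup (carrier A)\<^esub> \<in> algebra_auto F A"
    by (auto simp: algebra_auto_def BijGroup_def id_Bij module_hom_def mult_closed)
next
  fix \<phi> assume "\<phi> \<in> algebra_auto F A"
  then have \<phi>: "\<phi> \<in> Bij (carrier A)" and hom: "\<phi> \<in> module_hom F A A"
    and mult: "\<And>x y. x \<in> carrier A \<Longrightarrow> y \<in> carrier A \<Longrightarrow> \<phi> (x \<otimes> y) = \<phi> x \<otimes> \<phi> y"
    by (auto simp: algebra_auto_def)
  let ?\<psi> = "inv_into (carrier A) \<phi>"
  have closed: "?\<psi> x \<in> carrier A" if "x \<in> carrier A" for x
    using Bij_inv_into_mem[OF \<phi> that] .
  have "?\<psi> (x \<oplus> y) = ?\<psi> x \<oplus> ?\<psi> y" "?\<psi> (x \<otimes> y) = ?\<psi> x \<otimes> ?\<psi> y"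
    if "x \<in> carrier A" "y \<in> carrier A" for x y
    using that \<phi> hom mult mult_closed by (auto intro!: Bij_inv_into_lemma simp: module_hom_def)
  moreover have "?\<psi> (a \<odot> x) = a \<odot> ?\<psi> x" if "a \<in> carrier F" "x \<in> carrier A" for a x
  proof -
    have "\<phi> (a \<odot> ?\<psi> x) = a \<odot> x"
      using that \<phi> hom closed bij_betw_inv_into_right[of \<phi> "carrier A" "carrier A" x]
      by (simp add: module_hom_smult Bij_def)
    then show ?thesis
      using that \<phi> closed by (auto simp: Bij_def bij_betw_def intro!: inv_into_f_eq)
  qed
  ultimately show "inv\<^bsub>BijGroup (carrier A)\<^esub> \<phi> \<in> algebra_auto F A"
    using closed mult_closed restrict_inv_into_Bij[OF \<phi>]
    by (simp add: inv_BijGroup[OF \<phi>] algebra_auto_def module_hom_def)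
qed

lemma group_Algebra_AutoGroup: "group (Algebra_AutoGroup F A)"
  unfolding Algebra_AutoGroup_def
  using subgroup_algebra_auto group_BijGroup by (rule subgroup.subgroup_is_group)

end


section \<open>Prime characteristic\<close>

lemma inj_on_of_nat_CHAR: "inj_on (of_nat :: nat \<Rightarrow> 'a::semiring_1_cancel) {..<CHAR('a)}"
proof (rule linorder_inj_onI)
  fix i j assume "i < j" "j \<in> {..<CHAR('a)}"
  then show "(of_nat i :: 'a) \<noteq> of_nat j"
    using of_nat_eq_iff_char_dvd[OF \<open>i < j\<close>, where ?'a = 'a] by (auto dest: dvd_imp_le)
qed auto

lemma of_nat_power_CHAR:
  assumes "prime CHAR('a::comm_semiring_1)"
  shows "(of_nat n :: 'a) ^ CHAR('a) = of_nat n"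
  using freshmans_dream_sum[OF assms refl, of "\<lambda>_. 1" "{..<n}"] by simp

lemma funpow_commute:
  assumes "\<And>x. f (g x) = g (f x)"
  shows "g ((f ^^ n) x) = (f ^^ n) (g x)"
  by (induction n) (simp_all flip: assms)

lemma additive_of_nat_mult:
  fixes f :: "'a::ring_1 \<Rightarrow> 'a"
  assumes "additive f"
  shows "f (of_nat n * x) = of_nat n * f x"
  using assms by (induction n) (auto simp: distrib_right additive.add additive.zero)

lemma funpow_add_binomial:
  fixes f g :: "'a::comm_ring_1 \<Rightarrow> 'a"
  assumes f: "additive f" and g: "additive g" and commute: "\<And>x. f (g x) = g (f x)"
  shows "((\<lambda>x. f x + g x) ^^ n) x = (\<Sum>i\<le>n. of_nat (n choose i) * (f ^^ (n - i)) ((g ^^ i) x))"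
proof (induction n)
  case (Suc n)
  define T where "T i j = (f ^^ i) ((g ^^ j) x)" for i j
  have T_Suc: "f (T i j) = T (Suc i) j" "g (T i j) = T i (Suc j)" for i j
    by (simp_all add: T_def funpow_commute[of f g, OF commute])
  have "((\<lambda>x. f x + g x) ^^ Suc n) x
      = f (\<Sum>i\<le>n. of_nat (n choose i) * T (n - i) i) + g (\<Sum>i\<le>n. of_nat (n choose i) * T (n - i) i)"
    by (simp add: Suc T_def)
  also have "\<dots> = (\<Sum>i\<le>n. of_nat (n choose i) * T (Suc (n - i)) i)
      + (\<Sum>i\<le>n. of_nat (n choose i) * T (n - i) (Suc i))"
    by (simp add: additive.sum[OF f] additive.sum[OF g] additive_of_nat_mult[OF f]
        additive_of_nat_mult[OF g] T_Suc)
  also have "(\<Sum>i\<le>n. of_nat (n choose i) * T (Suc (n - i)) i)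
      = (\<Sum>i\<le>Suc n. of_nat (n choose i) * T (Suc n - i) i)"
    by (simp add: binomial_eq_0 Suc_diff_le)
  also have "\<dots> = T (Suc n) 0 + (\<Sum>i\<le>n. of_nat (n choose Suc i) * T (n - i) (Suc i))"
    by (subst sum.atMost_Suc_shift) simp
  also have "\<dots> + (\<Sum>i\<le>n. of_nat (n choose i) * T (n - i) (Suc i))
      = (\<Sum>i\<le>Suc n. of_nat (Suc n choose i) * T (Suc n - i) i)"
    by (subst sum.atMost_Suc_shift) (simp add: distrib_right sum.distrib add_ac)
  finally show ?case
    by (simp add: T_def)
qed simp

lemma funpow_add_CHAR:
  fixes f g :: "'a::comm_ring_1 \<Rightarrow> 'a"
  assumes "prime CHAR('a)"
    and "additive f" "additive g" "\<And>x. f (g x) = g (f x)"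
  shows "((\<lambda>x. f x + g x) ^^ CHAR('a)) x = (f ^^ CHAR('a)) x + (g ^^ CHAR('a)) x"
proof -
  let ?p = "CHAR('a)"
  let ?term = "\<lambda>i. of_nat (?p choose i) * (f ^^ (?p - i)) ((g ^^ i) x)"
  have "of_nat (?p choose i) = (0 :: 'a)" if "0 < i" "i < ?p" for i
    using that \<open>prime ?p\<close> dvd_choose_prime[of i ?p]
    by (simp add: of_nat_eq_0_iff_char_dvd)
  then have "(\<Sum>i\<le>?p. ?term i) = (\<Sum>i\<in>{0, ?p}. ?term i)"
    by (intro sum.mono_neutral_right) auto
  then show ?thesis
    using prime_gt_0_nat[OF \<open>prime ?p\<close>] assms(2-) by (simp add: funpow_add_binomial)
qed

definition artin_schreier_poly :: "nat \<Rightarrow> 'a::comm_ring_1 poly" where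
  "artin_schreier_poly p = Polynomial.monom 1 p - Polynomial.monom 1 1"

lemma degree_artin_schreier_poly:
  assumes "p > 1"
  shows "degree (artin_schreier_poly p :: 'a::comm_ring_1 poly) = p"
proof (rule antisym)
  show "degree (artin_schreier_poly p :: 'a poly) \<le> p"
    unfolding artin_schreier_poly_def
    using assms by (intro degree_diff_le) (auto intro: order.trans[OF degree_monom_le])
  show "p \<le> degree (artin_schreier_poly p :: 'a poly)"
    by (rule le_degree) (use assms in \<open>simp add: artin_schreier_poly_def\<close>)
qed

lemma artin_schreier_poly_eq_prod:
  assumes "prime CHAR('a::field)"
  shows "artin_schreier_poly CHAR('a) = (\<Prod>i<CHAR('a). [:- of_nat i, 1:] :: 'a poly)"
proof (rule poly_eqI_degree_lead_coeff[where n = "CHAR('a)" and A = "of_nat ` {..<CHAR('a)}"])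
  let ?p = "CHAR('a)" and ?P = "\<Prod>i<CHAR('a). [:- of_nat i, 1:] :: 'a poly"
  have gt_1: "?p > 1"
    using assms prime_gt_1_nat by blast
  have degree: "degree ?P = ?p"
    by (subst degree_prod_eq_sum_degree) auto
  then show "degree ?P \<le> ?p"
    by simp
  have "lead_coeff ?P = 1"
    by (simp add: lead_coeff_prod)
  then show "coeff (artin_schreier_poly ?p) ?p = coeff ?P ?p"
    using degree gt_1 by (simp add: artin_schreier_poly_def)
  show "degree (artin_schreier_poly ?p :: 'a poly) \<le> ?p"
    using gt_1 by (simp add: degree_artin_schreier_poly)
  show "?p \<le> card (of_nat ` {..<?p} :: 'a set)"
    by (simp add: card_image inj_on_of_nat_CHAR)
  fix z :: 'a assume "z \<in> of_nat ` {..<?p}"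
  then obtain i where "i < ?p" "z = of_nat i"
    by auto
  then show "poly (artin_schreier_poly ?p) z = poly ?P z"
    using of_nat_power_CHAR[OF assms]
    by (auto simp: artin_schreier_poly_def poly_prod poly_monom
        intro!: prod_zero[symmetric] bexI[of _ i])
qed

lemma pcompose_artin_schreier_poly:
  assumes "prime CHAR('a::comm_ring_1)"
  shows "pcompose (artin_schreier_poly CHAR('a)) [:1, 1:]
    = (artin_schreier_poly CHAR('a) :: 'a poly)"
proof -
  have monom: "pcompose (Polynomial.monom 1 n) q = q ^ n" for q :: "'a poly" and n
    by (induction n) (simp_all add: pcompose_1 monom_Suc pcompose_pCons)
  have monom_1_1: "Polynomial.monom 1 (Suc 0) = ([:0, 1:] :: 'a poly)"
    by (simp add: monom_altdef)
  have "([:1, 1:] :: 'a poly) ^ CHAR('a) = ([:0, 1:] + 1) ^ CHAR('a)"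
    by (simp add: one_pCons)
  also have "\<dots> = [:0, 1:] ^ CHAR('a) + 1 ^ CHAR('a)"
    by (rule freshmans_dream) (use assms in auto)
  finally have "([:1, 1:] :: 'a poly) ^ CHAR('a) = Polynomial.monom 1 CHAR('a) + 1"
    by (simp add: monom_altdef)
  then show ?thesis
    by (simp add: artin_schreier_poly_def pcompose_diff monom monom_1_1 pcompose_pCons one_pCons)
qed


section \<open>The differential polynomial ring\<close>

locale differential_field =
  fixes \<delta> :: "'a::field \<Rightarrow> 'a"
  assumes derivation: "derivation \<delta>"
begin

abbreviation T :: "'a poly \<Rightarrow> 'a poly" where "T \<equiv> t_mult \<delta>"

abbreviation dmult_op :: "'a poly \<Rightarrow> 'a poly \<Rightarrow> 'a poly"  (infixl \<open>\<bullet>\<close> 70) where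
  "h \<bullet> k \<equiv> dmult \<delta> h k"

lemma delta_mult: "\<delta> (a * b) = a * \<delta> b + \<delta> a * b"
  using derivation by (auto simp: derivation_def)

sublocale delta: additive \<delta>
  using derivation by unfold_locales (auto simp: derivation_def)

declare delta.zero [simp]

lemma delta_one [simp]: "\<delta> 1 = 0"
  using delta_mult[of 1 1] by (metis add_cancel_left_right mult_1 mult.right_neutral)

lemma delta_of_nat [simp]: "\<delta> (of_nat n) = 0"
  by (induction n) (auto simp: delta.add)

lemma delta_inverse_const: "\<delta> a = 0 \<Longrightarrow> \<delta> (inverse a) = 0"
  using delta_mult[of a "inverse a"] by (cases "a = 0") auto

lemma coeff_map_delta [simp]: "coeff (map_poly \<delta> k) n = \<delta> (coeff k n)"
  by (simp add: coeff_map_poly)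

sublocale map_delta: additive "map_poly \<delta>"
  by unfold_locales (rule poly_eqI, simp add: delta.add)

lemma map_delta_smult:
  "map_poly \<delta> (Polynomial.smult a k) = Polynomial.smult a (map_poly \<delta> k) + Polynomial.smult (\<delta> a) k"
  by (rule poly_eqI) (simp add: delta_mult)

sublocale t_mult: additive T
  by unfold_locales (simp add: t_mult_def map_delta.add)

declare t_mult.zero [simp]

lemma t_mult_pCons: "T (pCons a k) = pCons (\<delta> a) (T k + [:a:])"
  by (simp add: t_mult_def map_poly_pCons add.commute)

lemma t_mult_smult: "T (Polynomial.smult a k) = Polynomial.smult a (T k) + Polynomial.smult (\<delta> a) k"
  by (simp add: t_mult_def map_delta_smult smult_add_right add.assoc)

lemma coeff_t_mult: "coeff (T k) n = (if n = 0 then 0 else coeff k (n - 1)) + \<delta> (coeff k n)"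
  by (cases n) (auto simp: t_mult_def)

lemma degree_t_mult:
  assumes "k \<noteq> 0"
  shows "degree (T k) = Suc (degree k)"
  using assms by (intro antisym degree_le le_degree) (auto simp: coeff_t_mult coeff_eq_0)

lemma lead_coeff_t_mult: "lead_coeff (T k) = lead_coeff k"
  by (cases "k = 0") (auto simp: degree_t_mult coeff_t_mult coeff_eq_0)

lemma dmult_0_left [simp]: "0 \<bullet> k = 0"
  by (simp add: dmult_def)

lemma dmult_pCons: "pCons a h \<bullet> k = Polynomial.smult a k + h \<bullet> T k"
proof (cases "h = 0")
  case False
  then show ?thesis
    unfolding dmult_def degree_pCons_eq[OF False]
    by (subst sum.atMost_Suc_shift) (simp add: funpow_swap1)
qed (simp add: dmult_const_left)

lemma dmult_smult_left: "Polynomial.smult a h \<bullet> k = Polynomial.smult a (h \<bullet> k)"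
  by (induction h arbitrary: k) (simp_all add: dmult_pCons smult_add_right)

sublocale dmult_left: additive "\<lambda>h. h \<bullet> k" for k
proof
  show "(h + h') \<bullet> k = h \<bullet> k + h' \<bullet> k" for h h'
    by (induction h h' arbitrary: k rule: poly_induct2) (simp_all add: dmult_pCons smult_add_left)
qed

sublocale dmult_right: additive "\<lambda>k. h \<bullet> k" for h
proof
  show "h \<bullet> (k + k') = h \<bullet> k + h \<bullet> k'" for k k'
    by (induction h arbitrary: k k') (simp_all add: dmult_pCons smult_add_right t_mult.add)
qed

declare dmult_right.zero [simp]

lemma dmult_smult_right: "\<delta> c = 0 \<Longrightarrow> h \<bullet> Polynomial.smult c k = Polynomial.smult c (h \<bullet> k)"
  by (induction h arbitrary: k)
     (simp_all add: dmult_pCons smult_add_right t_mult_smult mult.commute)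

lemma t_mult_dmult: "T (h \<bullet> k) = T h \<bullet> k"
proof (induction h arbitrary: k)
  case (pCons a h)
  then show ?case
    by (simp add: t_mult_pCons dmult_pCons t_mult.add t_mult_smult dmult_left.add dmult_const_left)
qed simp

lemma dmult_assoc: "(h \<bullet> k) \<bullet> l = h \<bullet> (k \<bullet> l)"
  by (induction h arbitrary: k)
     (simp_all add: dmult_pCons dmult_left.add dmult_smult_left t_mult_dmult)

lemma dmult_monom_left: "Polynomial.monom a n \<bullet> k = Polynomial.smult a ((T ^^ n) k)"
  by (induction n arbitrary: k) (simp_all add: monom_0 monom_Suc dmult_pCons funpow_swap1)

definition const_coeffs :: "'a poly \<Rightarrow> bool" where
  "const_coeffs h \<longleftrightarrow> (\<forall>i. \<delta> (coeff h i) = 0)"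

lemma const_coeffs_0 [simp]: "const_coeffs 0"
  by (simp add: const_coeffs_def)

lemma const_coeffs_pCons [simp]: "const_coeffs (pCons a h) \<longleftrightarrow> \<delta> a = 0 \<and> const_coeffs h"
  unfolding const_coeffs_def by (auto simp: coeff_pCons split: nat.splits)

lemma dmult_const_coeffs_right:
  assumes "const_coeffs k"
  shows "h \<bullet> k = h * k"
  using assms
proof (induction h arbitrary: k)
  case (pCons a h)
  have "T k = pCons 0 k"
    by (rule poly_eqI) (use pCons.prems in \<open>simp add: t_mult_def const_coeffs_def\<close>)
  moreover have "h \<bullet> pCons 0 k = h * pCons 0 k"
    by (rule pCons.IH) (simp add: pCons.prems)
  ultimately show ?case
    by (simp add: dmult_pCons)
qed simp

lemma dmult_1_left [simp]: "1 \<bullet> k = k"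
  by (simp add: one_pCons dmult_const_left)

lemma dmult_1_right [simp]: "h \<bullet> 1 = h"
  by (simp add: dmult_const_coeffs_right const_coeffs_def coeff_1 if_distrib)

lemma degree_lead_coeff_dmult:
  assumes "h \<noteq> 0" "k \<noteq> 0"
  shows "degree (h \<bullet> k) = degree h + degree k \<and> lead_coeff (h \<bullet> k) = lead_coeff h * lead_coeff k"
  using assms
proof (induction h arbitrary: k)
  case (pCons a h)
  show ?case
  proof (cases "h = 0")
    case True
    with pCons show ?thesis
      by (simp add: dmult_const_left)
  next
    case False
    have "T k \<noteq> 0"
      using degree_t_mult[OF pCons.prems(2)] by auto
    note IH = pCons.IH[OF False this]
    have less: "degree (Polynomial.smult a k) < degree (h \<bullet> T k)"
      using IH degree_smult_le[of a k] degree_t_mult[OF pCons.prems(2)] by simp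
    have "degree (pCons a h \<bullet> k) = degree (pCons a h) + degree k"
      using IH False degree_add_eq_right[OF less] degree_t_mult[OF pCons.prems(2)]
      by (simp add: dmult_pCons)
    moreover have "lead_coeff (pCons a h \<bullet> k) = lead_coeff h * lead_coeff k"
      using IH lead_coeff_add_le[OF less] by (metis dmult_pCons lead_coeff_t_mult)
    ultimately show ?thesis
      using False by simp
  qed
qed simp

lemmas degree_dmult = degree_lead_coeff_dmult[THEN conjunct1]
  and lead_coeff_dmult = degree_lead_coeff_dmult[THEN conjunct2]

lemma dmult_eq_0_iff: "h \<bullet> k = 0 \<longleftrightarrow> h = 0 \<or> k = 0"
  using lead_coeff_dmult[of h k]
  by (metis dmult_0_left dmult_right.zero leading_coeff_0_iff mult_eq_0_iff)

lemma degree_dmult_le: "degree (h \<bullet> k) \<le> degree h + degree k"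
  by (cases "h = 0 \<or> k = 0") (auto simp: degree_dmult)

lemma coeff_funpow_t_mult_const:
  shows "coeff ((T ^^ n) [:a:]) n = a"
    and "coeff ((T ^^ Suc n) [:a:]) n = of_nat (Suc n) * \<delta> a"
    and "n < j \<Longrightarrow> coeff ((T ^^ n) [:a:]) j = 0"
proof -
  show zero: "coeff ((T ^^ n) [:a:]) j = 0" if "n < j" for n j
    using that by (induction n arbitrary: j) (auto simp: coeff_t_mult coeff_pCons split: nat.splits)
  show lead: "coeff ((T ^^ n) [:a:]) n = a" for n
    by (induction n) (simp_all add: coeff_t_mult zero)
  show "coeff ((T ^^ Suc n) [:a:]) n = of_nat (Suc n) * \<delta> a" for n
  proof (induction n)
    case (Suc n)
    then show ?case
      using lead[of "Suc n"]
      by (simp only: funpow.simps(2)[of "Suc n"] o_apply) (simp add: coeff_t_mult algebra_simps)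
  qed (simp add: coeff_t_mult)
qed

lemma subleading_coeff_dmult_const:
  assumes "degree h = Suc m"
  shows "coeff (h \<bullet> [:a:]) m = coeff h m * a + lead_coeff h * (of_nat (Suc m) * \<delta> a)"
proof -
  have "coeff (h \<bullet> [:a:]) m = (\<Sum>i<Suc (Suc m). coeff h i * coeff ((T ^^ i) [:a:]) m)"
    using assms by (simp add: dmult_def coeff_sum lessThan_Suc_atMost del: funpow.simps)
  also have "\<dots> = coeff h m * a + coeff h (Suc m) * (of_nat (Suc m) * \<delta> a)"
    unfolding sum.lessThan_Suc by (simp add: coeff_funpow_t_mult_const del: funpow.simps of_nat_Suc)
  finally show ?thesis
    by (simp add: assms)
qed

lemma funpow_t_mult_CHAR:
  assumes "prime CHAR('a)"
  shows "(T ^^ CHAR('a)) k = Polynomial.monom 1 CHAR('a) * k + map_poly (\<delta> ^^ CHAR('a)) k"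
proof -
  have "T = (\<lambda>k. pCons 0 k + map_poly \<delta> k)"
    by (simp add: fun_eq_iff t_mult_def)
  moreover have "((\<lambda>k. pCons 0 k + map_poly \<delta> k) ^^ CHAR('a poly)) k
      = (pCons 0 ^^ CHAR('a poly)) k + (map_poly \<delta> ^^ CHAR('a poly)) k"
    by (rule funpow_add_CHAR)
       (use assms map_delta.additive_axioms in \<open>simp_all add: additive_def map_poly_pCons\<close>)
  moreover have "(pCons 0 ^^ n) k = Polynomial.monom 1 n * k" for n
    by (induction n) (simp_all add: monom_Suc)
  moreover have "(\<delta> ^^ n) 0 = 0" for n
    by (induction n) simp_all
  then have "(map_poly \<delta> ^^ n) k = map_poly (\<delta> ^^ n) k" for n
    by (induction n) (simp_all add: map_poly_map_poly o_def)
  ultimately show ?thesis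
    by simp
qed


section \<open>Right division\<close>

lemma reduce_degree:
  assumes "f \<noteq> 0" "h \<noteq> 0" "degree f \<le> degree h"
  obtains m where "h - m \<bullet> f = 0 \<or> degree (h - m \<bullet> f) < degree h"
proof
  define m where "m = Polynomial.monom (lead_coeff h / lead_coeff f) (degree h - degree f)"
  have "m \<noteq> 0" and "degree m + degree f = degree h" "lead_coeff m * lead_coeff f = lead_coeff h"
    using assms by (auto simp: m_def degree_monom_eq)
  then have "degree (m \<bullet> f) = degree h" "coeff (m \<bullet> f) (degree h) = lead_coeff h"
    using assms(1) degree_dmult lead_coeff_dmult by metis+
  then have "degree (h - m \<bullet> f) \<le> degree h" "coeff (h - m \<bullet> f) (degree h) = 0"
    by (auto intro: degree_diff_le)
  then show "h - m \<bullet> f = 0 \<or> degree (h - m \<bullet> f) < degree h"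
    by (metis leading_coeff_0_iff le_neq_implies_less)
qed

lemma right_division:
  assumes "f \<noteq> 0"
  shows "\<exists>q r. h = q \<bullet> f + r \<and> (r = 0 \<or> degree r < degree f)"
proof (induction "degree h" arbitrary: h rule: less_induct)
  case less
  show ?case
  proof (cases "h = 0 \<or> degree h < degree f")
    case True
    then show ?thesis
      by (intro exI[of _ 0] exI[of _ h]) auto
  next
    case False
    then obtain m where "h - m \<bullet> f = 0 \<or> degree (h - m \<bullet> f) < degree h"
      using reduce_degree[OF assms] by (metis not_less)
    then have "\<exists>q r. h - m \<bullet> f = q \<bullet> f + r \<and> (r = 0 \<or> degree r < degree f)"
      using less[of "h - m \<bullet> f"] by (metis add.right_neutral dmult_0_left)
    then obtain q r where qr: "h - m \<bullet> f = q \<bullet> f + r" "r = 0 \<or> degree r < degree f"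
      by blast
    then have "h = (m + q) \<bullet> f + r"
      by (simp add: dmult_left.add algebra_simps)
    with qr(2) show ?thesis
      by blast
  qed
qed

lemma remainder_unique:
  assumes "q \<bullet> f + r = q' \<bullet> f + r'"
    and "r = 0 \<or> degree r < degree f" "r' = 0 \<or> degree r' < degree f"
  shows "r = r'"
proof (rule ccontr)
  assume "r \<noteq> r'"
  have multiple: "(q - q') \<bullet> f = r' - r"
    using assms(1) by (simp add: dmult_left.diff algebra_simps)
  with \<open>r \<noteq> r'\<close> have "q - q' \<noteq> 0" "f \<noteq> 0"
    using dmult_eq_0_iff by (metis right_minus_eq)+
  then have "degree f \<le> degree (r' - r)"
    using degree_dmult[of "q - q'" f] by (simp add: multiple)
  moreover have "degree (r' - r) < degree f"
    using assms(2,3) \<open>r \<noteq> r'\<close> by (auto intro: degree_diff_less)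
  ultimately show False
    by simp
qed

lemma mod_r_eqI:
  assumes "h = q \<bullet> f + r" "r = 0 \<or> degree r < degree f"
  shows "mod_r \<delta> h f = r"
  unfolding mod_r_def
proof (rule the_equality)
  fix r'
  assume "(\<exists>q. h = q \<bullet> f + r') \<and> (r' = 0 \<or> degree r' < degree f)"
  then show "r' = r"
    using remainder_unique assms by metis
qed (use assms in blast)

lemma mod_r_division:
  assumes "f \<noteq> 0"
  obtains q where "h = q \<bullet> f + mod_r \<delta> h f" "mod_r \<delta> h f = 0 \<or> degree (mod_r \<delta> h f) < degree f"
  using right_division[OF assms] mod_r_eqI by metis

lemma mod_r_dmult_self: "mod_r \<delta> (q \<bullet> f) f = 0"
  by (rule mod_r_eqI[of _ q]) auto

lemma mod_r_small: "degree h < degree f \<Longrightarrow> mod_r \<delta> h f = h"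
  by (rule mod_r_eqI[of _ 0]) auto

lemma additive_mod_r:
  assumes "f \<noteq> 0"
  shows "additive (\<lambda>h. mod_r \<delta> h f)"
proof
  fix h k
  obtain q where q: "h = q \<bullet> f + mod_r \<delta> h f" "mod_r \<delta> h f = 0 \<or> degree (mod_r \<delta> h f) < degree f"
    using mod_r_division[OF assms] .
  obtain q' where q': "k = q' \<bullet> f + mod_r \<delta> k f" "mod_r \<delta> k f = 0 \<or> degree (mod_r \<delta> k f) < degree f"
    using mod_r_division[OF assms] .
  show "mod_r \<delta> (h + k) f = mod_r \<delta> h f + mod_r \<delta> k f"
  proof (rule mod_r_eqI)
    show "h + k = (q + q') \<bullet> f + (mod_r \<delta> h f + mod_r \<delta> k f)"
      by (subst q(1), subst q'(1)) (simp add: dmult_left.add algebra_simps)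
  qed (use q(2) q'(2) in \<open>auto intro: degree_add_less\<close>)
qed

lemma mod_r_smult:
  assumes "f \<noteq> 0"
  shows "mod_r \<delta> (Polynomial.smult a h) f = Polynomial.smult a (mod_r \<delta> h f)"
proof -
  obtain q where q: "h = q \<bullet> f + mod_r \<delta> h f" "mod_r \<delta> h f = 0 \<or> degree (mod_r \<delta> h f) < degree f"
    using mod_r_division[OF assms] .
  show ?thesis
  proof (rule mod_r_eqI)
    show "Polynomial.smult a h = Polynomial.smult a q \<bullet> f + Polynomial.smult a (mod_r \<delta> h f)"
      by (subst q(1)) (simp add: dmult_smult_left smult_add_right)
  qed (use q(2) in auto)
qed

lemma mod_r_dmult_mod_r:
  assumes "f \<noteq> 0"
  shows "mod_r \<delta> (h \<bullet> mod_r \<delta> k f) f = mod_r \<delta> (h \<bullet> k) f"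
proof -
  interpret mod_r: additive "\<lambda>h. mod_r \<delta> h f"
    using assms by (rule additive_mod_r)
  obtain q where "k = q \<bullet> f + mod_r \<delta> k f"
    using mod_r_division[OF assms] .
  then have "h \<bullet> k = (h \<bullet> q) \<bullet> f + h \<bullet> mod_r \<delta> k f"
    by (metis dmult_assoc dmult_right.add)
  then show ?thesis
    by (simp add: mod_r.add mod_r_dmult_self)
qed

definition dirreducible :: "'a poly \<Rightarrow> bool" where
  "dirreducible f \<longleftrightarrow> (\<forall>q g. f = q \<bullet> g \<longrightarrow> degree g = 0 \<or> degree g = degree f)"

definition right_invariant :: "'a poly \<Rightarrow> bool" where
  "right_invariant f \<longleftrightarrow> (\<forall>z. mod_r \<delta> (f \<bullet> z) f = 0)"

text \<open>The Euclidean algorithm on \<open>f\<close> and \<open>k\<close> preserves a relation \<open>h k = q f\<close>, which bounds the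
  degree of the least common left multiple from below.\<close>

lemma common_right_divisor:
  assumes "h \<bullet> k = q \<bullet> f" "h \<noteq> 0" "k \<noteq> 0"
  shows "\<exists>g s s'. k = s \<bullet> g \<and> f = s' \<bullet> g \<and> degree f \<le> degree g + degree h"
  using assms
proof (induction "degree k" arbitrary: h k q f rule: less_induct)
  case less
  have nonzero: "q \<noteq> 0" "f \<noteq> 0"
    using less.prems dmult_eq_0_iff by metis+
  have degree: "degree h + degree k = degree q + degree f"
    using less.prems nonzero degree_dmult by metis
  obtain s r where division: "f = s \<bullet> k + r" "r = 0 \<or> degree r < degree k"
    using right_division[OF less.prems(3)] by blast
  show ?case
  proof (cases "r = 0")
    case True
    with division degree show ?thesis
      by (intro exI[of _ k] exI[of _ 1] exI[of _ s]) auto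
  next
    case False
    have "q \<bullet> r = (h - q \<bullet> s) \<bullet> k"
      using less.prems(1) division(1) by (simp add: dmult_left.diff dmult_right.add dmult_assoc)
    then obtain g s1 s2 where g: "r = s1 \<bullet> g" "k = s2 \<bullet> g" "degree k \<le> degree g + degree q"
      using less.hyps[of r q "h - q \<bullet> s" k] division(2) False nonzero less.prems by blast
    have "f = (s \<bullet> s2 + s1) \<bullet> g"
      using division(1) g by (simp add: dmult_left.add dmult_assoc)
    with g degree show ?thesis
      by (intro exI[of _ g] exI[of _ s2] exI[of _ "s \<bullet> s2 + s1"]) auto
  qed
qed

lemma dirreducible_degree_le:
  assumes "dirreducible f" "h \<bullet> k = q \<bullet> f" "h \<noteq> 0" "k \<noteq> 0"
  shows "degree f \<le> degree h \<or> degree f \<le> degree k"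
proof -
  obtain g s s' where g: "k = s \<bullet> g" "f = s' \<bullet> g" "degree f \<le> degree g + degree h"
    using common_right_divisor[OF assms(2-4)] by blast
  have "s \<noteq> 0" "g \<noteq> 0"
    using g(1) \<open>k \<noteq> 0\<close> by (auto simp: dmult_eq_0_iff)
  then have "degree g \<le> degree k"
    using g(1) by (simp add: degree_dmult)
  moreover have "degree g = 0 \<or> degree g = degree f"
    using \<open>dirreducible f\<close> g(2) by (auto simp: dirreducible_def)
  ultimately show ?thesis
    using g(3) by auto
qed


section \<open>Central polynomials up to constants\<close>

definition dcentral :: "'a poly \<Rightarrow> bool" where
  "dcentral c \<longleftrightarrow> (\<forall>k. c \<bullet> k = k \<bullet> c)"

lemma dcentral_diff_const_dmult:
  assumes "dcentral c"
  shows "(c - [:d:]) \<bullet> z = z \<bullet> (c - [:d:]) + (z \<bullet> [:d:] - Polynomial.smult d z)"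
  using assms by (simp add: dcentral_def dmult_left.diff dmult_right.diff dmult_const_left)

lemma commutator_const_eq_0_imp_CHAR_dvd_degree:
  assumes "h \<bullet> [:a:] = Polynomial.smult a h" "\<delta> a \<noteq> 0"
  shows "CHAR('a) dvd degree h"
proof (cases "degree h")
  case (Suc m)
  then have "lead_coeff h * (of_nat (Suc m) * \<delta> a) = 0"
    using subleading_coeff_dmult_const[OF Suc, of a] assms(1) by (simp del: of_nat_Suc)
  moreover have "lead_coeff h \<noteq> 0"
    using Suc by (metis degree_0 leading_coeff_0_iff nat.distinct(1))
  ultimately have "(of_nat (Suc m) :: 'a) = 0"
    using assms(2) by (simp del: of_nat_Suc)
  then show ?thesis
    by (simp add: Suc of_nat_eq_0_iff_char_dvd del: of_nat_Suc)
qed simp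

lemma degree_commutator_const_less:
  assumes "h \<bullet> [:a:] \<noteq> Polynomial.smult a h"
  shows "degree (h \<bullet> [:a:] - Polynomial.smult a h) < degree h"
proof -
  define e where "e = h \<bullet> [:a:] - Polynomial.smult a h"
  have "a \<noteq> 0" "h \<noteq> 0"
    using assms by auto
  then have "degree e \<le> degree h" "coeff e (degree h) = 0"
    using degree_dmult[of h "[:a:]"] lead_coeff_dmult[of h "[:a:]"]
    by (auto simp: e_def intro: degree_diff_le)
  moreover have "e \<noteq> 0"
    using assms by (simp add: e_def)
  ultimately show ?thesis
    unfolding e_def[symmetric] by (metis leading_coeff_0_iff le_neq_implies_less)
qed

lemma CHAR_dvd_degree_right_divisor:
  assumes "dcentral c" "c - [:d:] = q \<bullet> g" "\<delta> d \<noteq> 0"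
  shows "CHAR('a) dvd degree g"
proof -
  have "g \<bullet> [:d:] - Polynomial.smult d g = ((c - [:d:]) - g \<bullet> q) \<bullet> g"
    using dcentral_diff_const_dmult[OF assms(1), of d g] assms(2)
    by (simp add: dmult_left.diff dmult_assoc algebra_simps)
  then have "g \<bullet> [:d:] - Polynomial.smult d g = 0"
    using degree_commutator_const_less[of g d] degree_dmult dmult_eq_0_iff
    by (metis add_lessD1 add.commute less_irrefl right_minus_eq)
  then show ?thesis
    using commutator_const_eq_0_imp_CHAR_dvd_degree assms(3) by simp
qed

lemma dirreducible_dcentral_diff_const:
  assumes "dcentral c" "degree c = CHAR('a)" "CHAR('a) > 0" "\<delta> d \<noteq> 0"
  shows "dirreducible (c - [:d:])"
  unfolding dirreducible_def
proof (intro allI impI)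
  fix q g assume factors: "c - [:d:] = q \<bullet> g"
  have degree: "degree (c - [:d:]) = CHAR('a)"
    using assms(2,3) degree_add_eq_left[of "- [:d:]" c] by (simp del: minus_pCons)
  then have "q \<noteq> 0" "g \<noteq> 0"
    using factors assms(3) by (auto simp: dmult_eq_0_iff)
  then have "degree g \<le> CHAR('a)"
    using factors degree by (simp add: degree_dmult)
  moreover have "CHAR('a) dvd degree g"
    using CHAR_dvd_degree_right_divisor[OF assms(1) factors assms(4)] .
  ultimately show "degree g = 0 \<or> degree g = degree (c - [:d:])"
    using degree by (auto dest: dvd_imp_le)
qed


section \<open>Shifting the indeterminate\<close>

definition shift :: "'a \<Rightarrow> 'a poly \<Rightarrow> 'a poly" where
  "shift a h = pcompose h [:a, 1:]"

sublocale shift: additive "shift a" for a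
  by unfold_locales (simp add: shift_def pcompose_add)

declare shift.zero [simp]

lemma shift_smult: "shift a (Polynomial.smult b h) = Polynomial.smult b (shift a h)"
  by (simp add: shift_def pcompose_smult)

lemma shift_const [simp]: "shift a [:b:] = [:b:]"
  by (simp add: shift_def)

lemma shift_pCons:
  "shift a (pCons b h) = [:b:] + Polynomial.smult a (shift a h) + pCons 0 (shift a h)"
  by (simp add: shift_def pcompose_pCons)

lemma degree_shift [simp]: "degree (shift a h) = degree h"
  by (simp add: shift_def degree_pcompose)

lemma shift_shift: "shift a (shift b h) = shift (a + b) h"
  by (simp add: shift_def pcompose_assoc[symmetric] pcompose_pCons add.commute)

lemma shift_0 [simp]: "shift 0 h = h"
  by (simp add: shift_def)

lemma shift_map_delta:
  assumes "\<delta> a = 0"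
  shows "shift a (map_poly \<delta> k) = map_poly \<delta> (shift a k)"
  by (induction k) (simp_all add: map_poly_pCons shift_pCons map_delta.add map_delta_smult assms)

lemma shift_t_mult:
  assumes "\<delta> a = 0"
  shows "shift a (T k) = T (shift a k) + Polynomial.smult a (shift a k)"
  by (simp add: t_mult_def shift.add shift_pCons shift_map_delta assms algebra_simps)

lemma shift_dmult:
  assumes "\<delta> a = 0"
  shows "shift a (h \<bullet> k) = shift a h \<bullet> shift a k"
proof (induction h arbitrary: k)
  case (pCons b h)
  have "pCons 0 h \<bullet> k = h \<bullet> T k" for h k
    by (simp add: dmult_pCons)
  then show ?case
    by (simp add: dmult_pCons[of b h] shift.add shift_smult pCons.IH shift_t_mult
        shift_pCons[of a b h] dmult_left.add dmult_right.add dmult_smult_left dmult_smult_right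
        dmult_const_left assms)
qed simp

lemma shift_mod_r:
  assumes "\<delta> a = 0" "shift a f = f" "f \<noteq> 0"
  shows "shift a (mod_r \<delta> h f) = mod_r \<delta> (shift a h) f"
proof -
  obtain q where q: "h = q \<bullet> f + mod_r \<delta> h f" "mod_r \<delta> h f = 0 \<or> degree (mod_r \<delta> h f) < degree f"
    using mod_r_division[OF \<open>f \<noteq> 0\<close>] .
  have "shift a h = shift a q \<bullet> f + shift a (mod_r \<delta> h f)"
    by (subst q(1)) (simp add: shift.add shift_dmult assms)
  then show ?thesis
    using q(2) by (intro mod_r_eqI[symmetric]) auto
qed


section \<open>Eigenvectors of a derivation\<close>

lemma poly_of_map_0 [simp]: "poly_of_map \<delta> 0 x = 0"
  by (simp add: poly_of_map_def)

lemma poly_of_map_pCons: "poly_of_map \<delta> (pCons a h) x = a * x + poly_of_map \<delta> h (\<delta> x)"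
proof (cases "h = 0")
  case False
  then show ?thesis
    unfolding poly_of_map_def degree_pCons_eq[OF False]
    by (subst sum.atMost_Suc_shift) (simp add: funpow_swap1)
qed (simp add: poly_of_map_def)

lemma poly_of_map_add: "poly_of_map \<delta> (h + k) x = poly_of_map \<delta> h x + poly_of_map \<delta> k x"
  by (induction h k arbitrary: x rule: poly_induct2) (simp_all add: poly_of_map_pCons algebra_simps)

lemma poly_of_map_smult: "poly_of_map \<delta> (Polynomial.smult a h) x = a * poly_of_map \<delta> h x"
  by (induction h arbitrary: x) (simp_all add: poly_of_map_pCons algebra_simps)

lemma poly_of_map_monom: "poly_of_map \<delta> (Polynomial.monom a n) x = a * (\<delta> ^^ n) x"
  by (induction n arbitrary: x) (simp_all add: monom_0 monom_Suc poly_of_map_pCons funpow_swap1)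

lemma poly_of_map_t_mult: "poly_of_map \<delta> (T h) x = \<delta> (poly_of_map \<delta> h x)"
  by (induction h arbitrary: x)
     (simp_all add: t_mult_pCons poly_of_map_pCons poly_of_map_add delta.add delta_mult)

lemma poly_of_map_dmult: "poly_of_map \<delta> (h \<bullet> k) x = poly_of_map \<delta> h (poly_of_map \<delta> k x)"
  by (induction h arbitrary: k)
     (simp_all add: dmult_pCons poly_of_map_pCons poly_of_map_add poly_of_map_smult
       poly_of_map_t_mult)

lemma poly_of_map_linear_mult:
  assumes "\<delta> a = 0"
  shows "poly_of_map \<delta> ([:- a, 1:] * h) x = poly_of_map \<delta> h (\<delta> x - a * x)"
proof -
  have "[:- a, 1:] * h = h \<bullet> [:- a, 1:]"
    using assms
    by (subst dmult_const_coeffs_right) (simp_all add: delta.minus)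
  then show ?thesis
    by (simp add: poly_of_map_dmult poly_of_map_pCons)
qed

lemma delta_poly_const_coeffs: "const_coeffs g \<Longrightarrow> \<delta> a = 0 \<Longrightarrow> \<delta> (poly g a) = 0"
  by (induction g) (simp_all add: delta.add delta_mult)

lemma const_coeffs_synthetic_div: "const_coeffs g \<Longrightarrow> \<delta> a = 0 \<Longrightarrow> const_coeffs (synthetic_div g a)"
  by (induction g) (simp_all add: delta_poly_const_coeffs)

definition eigenvector :: "'a \<Rightarrow> 'a \<Rightarrow> bool" where
  "eigenvector a u \<longleftrightarrow> u \<noteq> 0 \<and> \<delta> u = a * u"

text \<open>Write the minimum polynomial as \<open>(t - a) h\<close>. By minimality \<open>h(\<delta>)\<close> does not vanish on \<open>K\<close>,
  and its nonzero values are eigenvectors.\<close>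

lemma eigenvector_of_minimum_polynomial_root:
  assumes "is_minimum_polynomial \<delta> g" "poly g a = 0" "\<delta> a = 0"
  shows "\<exists>u. eigenvector a u"
proof -
  define h where "h = synthetic_div g a"
  have g: "g = [:- a, 1:] * h"
    using synthetic_div_correct'[of a g] assms(2) by (simp add: h_def)
  have const: "const_coeffs h"
    unfolding h_def using assms(1,3)
    by (intro const_coeffs_synthetic_div)
       (simp_all add: is_minimum_polynomial_def constants_def const_coeffs_def)
  have "g \<noteq> 0"
    using assms(1) by (auto simp: is_minimum_polynomial_def)
  then have "h \<noteq> 0"
    using g by auto
  then have "degree h < degree g"
    using degree_synthetic_div[of g a] synthetic_div_eq_0_iff[of g a] by (simp add: h_def)
  then obtain x where x: "poly_of_map \<delta> h x \<noteq> 0"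
    using assms(1) const \<open>h \<noteq> 0\<close>
    unfolding is_minimum_polynomial_def constants_def const_coeffs_def mem_Collect_eq
      not_less[symmetric]
    by blast
  have "g = [:- a, 1:] \<bullet> h"
    using g dmult_const_coeffs_right[OF const] by simp
  then have "\<delta> (poly_of_map \<delta> h x) - a * poly_of_map \<delta> h x = poly_of_map \<delta> g x"
    by (simp add: poly_of_map_dmult poly_of_map_pCons)
  also have "\<dots> = 0"
    using assms(1) by (simp add: is_minimum_polynomial_def)
  finally show ?thesis
    using x by (auto simp: eigenvector_def)
qed

lemma eigenvector_power: "eigenvector 1 u \<Longrightarrow> eigenvector (of_nat i) (u ^ i)"
  by (induction i) (auto simp: eigenvector_def delta_mult algebra_simps)

lemma eigenspace_one_dimensional:
  assumes "eigenvector a u" "\<delta> y = a * y"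
  obtains e where "\<delta> e = 0" "y = e * u"
proof
  have u: "u \<noteq> 0" "\<delta> u = a * u"
    using assms(1) by (auto simp: eigenvector_def)
  then show y: "y = (y / u) * u"
    by simp
  have "\<delta> y = (y / u) * \<delta> u + \<delta> (y / u) * u"
    by (subst y) (rule delta_mult)
  then have "\<delta> (y / u) * u = 0"
    using assms(2) u by simp
  then show "\<delta> (y / u) = 0"
    using u(1) by simp
qed

lemma eigenvectors_independent:
  assumes "finite I" "inj_on \<mu> I"
    and "\<And>i. i \<in> I \<Longrightarrow> \<delta> (\<mu> i) = 0 \<and> eigenvector (\<mu> i) (u i) \<and> \<delta> (a i) = 0"
    and "(\<Sum>i\<in>I. a i * u i) = 0"
  shows "\<forall>i\<in>I. a i = 0"
  using assms
proof (induction I arbitrary: a rule: finite_induct)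
  case (insert k I)
  let ?s = "\<Sum>i\<in>insert k I. a i * u i"
  have "\<delta> (a i * u i) = a i * \<mu> i * u i" if "i \<in> insert k I" for i
    using that insert.prems(2)[OF that] by (simp add: delta_mult eigenvector_def)
  then have "\<delta> ?s - \<mu> k * ?s = (\<Sum>i\<in>insert k I. a i * (\<mu> i - \<mu> k) * u i)"
    unfolding delta.sum sum_distrib_left sum_subtractf[symmetric]
    by (intro sum.cong refl) (simp only:, simp add: algebra_simps)
  then have "(\<Sum>i\<in>I. a i * (\<mu> i - \<mu> k) * u i) = 0"
    using insert.hyps insert.prems(3) by simp
  then have "\<forall>i\<in>I. a i * (\<mu> i - \<mu> k) = 0"
    using insert.prems(1,2)
    by (intro insert.IH) (auto simp: delta_mult delta.diff)
  then have "\<forall>i\<in>I. a i = 0"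
    using insert.prems(1) insert.hyps(2) by (auto simp: inj_on_def)
  moreover from this have "a k = 0"
    using insert.hyps insert.prems(2,3) by (simp add: eigenvector_def)
  ultimately show ?case
    by simp
qed simp

lemma delta_minus_const_surj_on_eigenvectors:
  assumes "\<And>i. i \<in> I \<Longrightarrow> \<delta> (\<mu> i) = 0 \<and> eigenvector (\<mu> i) (u i) \<and> \<delta> (a i) = 0"
    and "\<delta> c = 0" "c \<notin> \<mu> ` I"
  obtains b where "\<And>i. i \<in> I \<Longrightarrow> \<delta> (b i) = 0"
    and "\<delta> (\<Sum>i\<in>I. b i * u i) - c * (\<Sum>i\<in>I. b i * u i) = (\<Sum>i\<in>I. a i * u i)"
proof
  define b where "b i = a i * inverse (\<mu> i - c)" for i
  show const: "\<delta> (b i) = 0" if "i \<in> I" for i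
    using assms(1)[OF that] assms(2) by (simp add: b_def delta_mult delta_inverse_const delta.diff)
  have "\<delta> (b i * u i) - c * (b i * u i) = a i * u i" if "i \<in> I" for i
  proof -
    have "\<mu> i - c \<noteq> 0"
      using that assms(3) by auto
    then have a: "b i * (\<mu> i - c) = a i"
      by (simp add: b_def)
    have "\<delta> (b i * u i) = b i * (\<mu> i * u i)"
      using assms(1)[OF that] const[OF that] by (simp add: delta_mult eigenvector_def)
    then show ?thesis
      by (simp add: algebra_simps flip: a)
  qed
  then show "\<delta> (\<Sum>i\<in>I. b i * u i) - c * (\<Sum>i\<in>I. b i * u i) = (\<Sum>i\<in>I. a i * u i)"
    by (simp add: delta.sum sum_distrib_left flip: sum_subtractf)
qed

lemma eigenvectors_span_kernel:
  assumes "finite I" "inj_on \<mu> I"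
    and "\<And>i. i \<in> I \<Longrightarrow> \<delta> (\<mu> i) = 0 \<and> eigenvector (\<mu> i) (u i)"
    and "poly_of_map \<delta> (\<Prod>i\<in>I. [:- \<mu> i, 1:]) x = 0"
  shows "\<exists>a. (\<forall>i\<in>I. \<delta> (a i) = 0) \<and> x = (\<Sum>i\<in>I. a i * u i)"
  using assms
proof (induction I arbitrary: x rule: finite_induct)
  case empty
  then show ?case
    by (simp add: one_pCons poly_of_map_pCons)
next
  case (insert k I)
  have "poly_of_map \<delta> (\<Prod>i\<in>I. [:- \<mu> i, 1:]) (\<delta> x - \<mu> k * x) = 0"
    using insert.prems(2)[of k] insert.prems(3)
    unfolding prod.insert[OF insert.hyps] by (simp only: poly_of_map_linear_mult insertI1)
  then obtain a where a: "\<forall>i\<in>I. \<delta> (a i) = 0" "\<delta> x - \<mu> k * x = (\<Sum>i\<in>I. a i * u i)"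
    using insert.IH[of "\<delta> x - \<mu> k * x"] insert.prems(1,2) by auto
  have new: "\<mu> k \<notin> \<mu> ` I"
    using insert.hyps(2) insert.prems(1) by (auto simp: inj_on_def)
  have eigen: "\<delta> (\<mu> i) = 0 \<and> eigenvector (\<mu> i) (u i) \<and> \<delta> (a i) = 0" if "i \<in> I" for i
    using that a(1) insert.prems(2) by blast
  have const: "\<delta> (\<mu> k) = 0"
    using insert.prems(2) by blast
  obtain b where b: "\<And>i. i \<in> I \<Longrightarrow> \<delta> (b i) = 0"
    "\<delta> (\<Sum>i\<in>I. b i * u i) - \<mu> k * (\<Sum>i\<in>I. b i * u i) = (\<Sum>i\<in>I. a i * u i)"
    using delta_minus_const_surj_on_eigenvectors[OF eigen const new] by blast
  with a(2) have "\<delta> (x - (\<Sum>i\<in>I. b i * u i)) = \<mu> k * (x - (\<Sum>i\<in>I. b i * u i))"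
    by (simp add: delta.diff algebra_simps)
  then obtain e where e: "\<delta> e = 0" "x - (\<Sum>i\<in>I. b i * u i) = e * u k"
    using eigenspace_one_dimensional insert.prems(2) by blast
  have "(\<Sum>i\<in>I. (b(k := e)) i * u i) = (\<Sum>i\<in>I. b i * u i)"
    by (rule sum.cong) (use insert.hyps in auto)
  then have "x = (\<Sum>i\<in>insert k I. (b(k := e)) i * u i)"
    using e(2) insert.hyps by (simp add: algebra_simps)
  then show ?case
    using b(1) e(1) by (intro exI[of _ "b(k := e)"]) simp
qed

definition basis_over_constants :: "'i set \<Rightarrow> ('i \<Rightarrow> 'a) \<Rightarrow> bool" where
  "basis_over_constants I b \<longleftrightarrow> finite I \<and>
     (\<forall>a. (\<forall>i\<in>I. \<delta> (a i) = 0) \<longrightarrow> (\<Sum>i\<in>I. a i * b i) = 0 \<longrightarrow> (\<forall>i\<in>I. a i = 0)) \<and>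
     (\<forall>x. \<exists>a. (\<forall>i\<in>I. \<delta> (a i) = 0) \<and> x = (\<Sum>i\<in>I. a i * b i))"

lemma eigenvectors_basis:
  assumes "finite I" "inj_on \<mu> I"
    and "\<And>i. i \<in> I \<Longrightarrow> \<delta> (\<mu> i) = 0 \<and> eigenvector (\<mu> i) (u i)"
    and "\<And>x. poly_of_map \<delta> (\<Prod>i\<in>I. [:- \<mu> i, 1:]) x = 0"
  shows "basis_over_constants I u"
  unfolding basis_over_constants_def
  using assms(1,3) eigenvectors_independent[OF assms(1,2)]
    eigenvectors_span_kernel[OF assms(1-4)]
  by blast

lemma artin_schreier_basis:
  assumes "is_minimum_polynomial \<delta> (artin_schreier_poly CHAR('a))" "CHAR('a) > 0"
  obtains u where "basis_over_constants {..<CHAR('a)} (\<lambda>i. u ^ i)"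
proof -
  have prime: "prime CHAR('a)"
    using prime_CHAR_semidom assms(2) .
  have "poly (artin_schreier_poly CHAR('a)) (1 :: 'a) = 0"
    by (simp add: artin_schreier_poly_def poly_monom)
  then obtain u where u: "eigenvector 1 u"
    using eigenvector_of_minimum_polynomial_root[OF assms(1)] delta_one by blast
  have "basis_over_constants {..<CHAR('a)} (\<lambda>i. u ^ i)"
  proof (rule eigenvectors_basis)
    show "inj_on (of_nat :: nat \<Rightarrow> 'a) {..<CHAR('a)}"
      by (rule inj_on_of_nat_CHAR)
    show "poly_of_map \<delta> (\<Prod>i<CHAR('a). [:- of_nat i, 1:]) x = 0" for x
      using assms(1)
      by (simp add: is_minimum_polynomial_def flip: artin_schreier_poly_eq_prod[OF prime])
  qed (use eigenvector_power[OF u] in simp_all)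
  with that show thesis .
qed

lemma dcentral_artin_schreier_poly:
  assumes "prime CHAR('a)" "\<And>x. poly_of_map \<delta> (artin_schreier_poly CHAR('a)) x = 0"
  shows "dcentral (artin_schreier_poly CHAR('a))"
  unfolding dcentral_def
proof
  fix k
  let ?c = "artin_schreier_poly CHAR('a)"
  have "(\<delta> ^^ CHAR('a)) x = \<delta> x" for x
    using assms(2)[of x] poly_of_map_add[of ?c "Polynomial.monom 1 1" x]
    by (simp add: artin_schreier_poly_def poly_of_map_monom)
  then have "(T ^^ CHAR('a)) k = Polynomial.monom 1 CHAR('a) * k + map_poly \<delta> k"
    using funpow_t_mult_CHAR[OF assms(1), of k] by (simp cong: map_poly_cong)
  then have "?c \<bullet> k = k * ?c"
    by (simp add: artin_schreier_poly_def dmult_left.diff dmult_monom_left t_mult_def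
        dmult_pCons algebra_simps monom_Suc)
  also have "\<dots> = k \<bullet> ?c"
    by (rule dmult_const_coeffs_right[symmetric])
       (auto simp: artin_schreier_poly_def delta.diff const_coeffs_def)
  finally show "?c \<bullet> k = k \<bullet> ?c" .
qed


section \<open>Petit algebras\<close>

abbreviation F :: "'a ring" where "F \<equiv> constant_field \<delta>"

lemma constant_field_simps [simp]:
  "carrier F = {a. \<delta> a = 0}" "x \<otimes>\<^bsub>F\<^esub> y = x * y" "x \<oplus>\<^bsub>F\<^esub> y = x + y" "\<one>\<^bsub>F\<^esub> = 1" "\<zero>\<^bsub>F\<^esub> = 0"
  by (auto simp: constant_field_def constants_def)

lemma field_constant_field: "field F"
proof (rule cring.cring_fieldI)
  show "cring F"
  proof (rule cringI)
    show "abelian_group F"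
      by (rule abelian_groupI)
         (auto simp: delta.add delta.minus algebra_simps intro!: exI[of _ "- _"])
    show "Group.comm_monoid F"
      by (rule comm_monoidI) (auto simp: delta_mult algebra_simps)
  qed (auto simp: algebra_simps)
  show "Units F = carrier F - {\<zero>\<^bsub>F\<^esub>}"
  proof (intro equalityI subsetI)
    fix x assume "x \<in> carrier F - {\<zero>\<^bsub>F\<^esub>}"
    then show "x \<in> Units F"
      by (auto simp: Units_def delta_inverse_const intro!: exI[of _ "inverse x"])
  qed (auto simp: Units_def)
qed

end

locale petit = differential_field \<delta> for \<delta> :: "'a::field \<Rightarrow> 'a" +
  fixes f :: "'a poly"
  assumes degree_pos: "0 < degree f"
begin

abbreviation A :: "('a, 'a poly) module" where "A \<equiv> petit_algebra \<delta> f"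

lemma petit_algebra_simps [simp]:
  "carrier A = {h. degree h < degree f}" "x \<otimes>\<^bsub>A\<^esub> y = mod_r \<delta> (x \<bullet> y) f" "x \<oplus>\<^bsub>A\<^esub> y = x + y"
  "\<one>\<^bsub>A\<^esub> = 1" "\<zero>\<^bsub>A\<^esub> = 0" "a \<odot>\<^bsub>A\<^esub> x = Polynomial.smult a x"
  by (auto simp: petit_algebra_def)

lemma f_nonzero [simp]: "f \<noteq> 0"
  using degree_pos by auto

sublocale mod_r: additive "\<lambda>h. mod_r \<delta> h f"
  by (rule additive_mod_r) simp

lemma degree_mod_r: "degree (mod_r \<delta> h f) < degree f"
  using mod_r_division[OF f_nonzero, of h] degree_pos by (metis degree_0)

lemma vectorspace_petit: "vectorspace F A"
proof (rule vs_criteria[OF field_constant_field])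
  show "\<forall>v\<in>carrier A. \<exists>neg_v\<in>carrier A. v \<oplus>\<^bsub>A\<^esub> neg_v = \<zero>\<^bsub>A\<^esub>"
    by (auto intro!: exI[of _ "- _"])
qed (use degree_pos in \<open>auto simp: degree_add_less smult_add_left smult_add_right algebra_simps
      intro: le_less_trans[OF degree_smult_le]\<close>)

sublocale petit: vectorspace F A
  by (rule vectorspace_petit)

sublocale petit: unital_algebra F A
proof
  show "(x \<oplus>\<^bsub>A\<^esub> y) \<otimes>\<^bsub>A\<^esub> z = x \<otimes>\<^bsub>A\<^esub> z \<oplus>\<^bsub>A\<^esub> y \<otimes>\<^bsub>A\<^esub> z" for x y z
    by (simp add: dmult_left.add mod_r.add)
  show "x \<otimes>\<^bsub>A\<^esub> (y \<oplus>\<^bsub>A\<^esub> z) = x \<otimes>\<^bsub>A\<^esub> y \<oplus>\<^bsub>A\<^esub> x \<otimes>\<^bsub>A\<^esub> z" for x y z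
    by (simp add: dmult_right.add mod_r.add)
qed (use degree_pos in \<open>auto simp: degree_mod_r dmult_smult_left dmult_smult_right mod_r_smult
      mod_r_small\<close>)

lemma finsum_petit:
  assumes "\<And>i. i \<in> S \<Longrightarrow> degree (g i) < degree f"
  shows "finsum A g S = sum g S"
  using assms
proof (induction S rule: infinite_finite_induct)
  case (insert i S)
  then show ?case
    by (subst petit.finsum_insert) auto
qed (use petit.finsum_empty petit.finsum_infinite in simp_all)

lemma minus_petit:
  assumes "y \<in> carrier A"
  shows "x \<ominus>\<^bsub>A\<^esub> y = x - y"
proof -
  have "\<ominus>\<^bsub>A\<^esub> y = - y"
    using assms by (intro petit.minus_equality) auto
  then show ?thesis
    by (simp add: a_minus_def)
qed


subsection \<open>Dimension\<close>

definition monom_family :: "('i \<Rightarrow> 'a) \<Rightarrow> 'i \<times> nat \<Rightarrow> 'a poly" where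
  "monom_family b = (\<lambda>(i, l). Polynomial.monom (b i) l)"

lemma monom_family_closed: "monom_family b \<in> I \<times> {..<degree f} \<rightarrow> carrier A"
  by (auto simp: monom_family_def intro: le_less_trans[OF degree_monom_le])

lemma coeff_finsum_monom_family:
  "coeff (\<Oplus>\<^bsub>A\<^esub>j\<in>I \<times> {..<degree f}. a j \<odot>\<^bsub>A\<^esub> monom_family b j) l
    = (if l < degree f then \<Sum>i\<in>I. a (i, l) * b i else 0)"
proof -
  have "degree (Polynomial.smult (a j) (monom_family b j)) < degree f"
    if "j \<in> I \<times> {..<degree f}" for j
    using monom_family_closed[of b I] that by (auto intro: le_less_trans[OF degree_smult_le])
  then have "(\<Oplus>\<^bsub>A\<^esub>j\<in>I \<times> {..<degree f}. a j \<odot>\<^bsub>A\<^esub> monom_family b j)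
      = (\<Sum>i\<in>I. \<Sum>k<degree f. Polynomial.smult (a (i, k)) (Polynomial.monom (b i) k))"
    by (simp add: finsum_petit sum.cartesian_product monom_family_def case_prod_unfold)
  moreover have "(\<Sum>k<degree f. a (i, k) * (if k = l then b i else 0))
      = (if l < degree f then a (i, l) * b i else 0)" for i
    by (simp add: if_distrib[of "\<lambda>y. _ * y"] cong: if_cong)
  ultimately show ?thesis
    by (simp add: coeff_sum)
qed

lemma lin_indpt_monom_family:
  assumes "basis_over_constants I b"
  shows "petit.lin_indpt_family (I \<times> {..<degree f}) (monom_family b)"
  unfolding petit.lin_indpt_family_def
proof (intro ballI impI)
  fix a j
  assume a: "a \<in> I \<times> {..<degree f} \<rightarrow> carrier F" and j: "j \<in> I \<times> {..<degree f}"
    and zero: "(\<Oplus>\<^bsub>A\<^esub>j\<in>I \<times> {..<degree f}. a j \<odot>\<^bsub>A\<^esub> monom_family b j) = \<zero>\<^bsub>A\<^esub>"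
  have indep: "(\<forall>i\<in>I. \<delta> (c i) = 0) \<Longrightarrow> (\<Sum>i\<in>I. c i * b i) = 0 \<Longrightarrow> \<forall>i\<in>I. c i = 0" for c
    using assms by (simp add: basis_over_constants_def)
  have "\<forall>i\<in>I. a (i, l) = 0" if "l < degree f" for l
  proof -
    have "(\<Sum>i\<in>I. a (i, l) * b i) = 0"
      using coeff_finsum_monom_family[of a b I l] that unfolding zero by simp
    moreover have "\<forall>i\<in>I. \<delta> (a (i, l)) = 0"
      using a that by auto
    ultimately show ?thesis
      using indep[of "\<lambda>i. a (i, l)"] by simp
  qed
  with j show "a j = \<zero>\<^bsub>F\<^esub>"
    by auto
qed

lemma spanning_monom_family:
  assumes "basis_over_constants I b"
  shows "petit.spanning_family (I \<times> {..<degree f}) (monom_family b)"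
  unfolding petit.spanning_family_def
proof
  fix v assume v: "v \<in> carrier A"
  have "\<exists>c. (\<forall>i\<in>I. \<delta> (c i) = 0) \<and> coeff v l = (\<Sum>i\<in>I. c i * b i)" for l
    using assms by (simp add: basis_over_constants_def)
  then obtain c where c: "\<And>l i. i \<in> I \<Longrightarrow> \<delta> (c l i) = 0" "\<And>l. coeff v l = (\<Sum>i\<in>I. c l i * b i)"
    by metis
  let ?a = "\<lambda>(i, l). c l i"
  have "coeff v l = coeff (\<Oplus>\<^bsub>A\<^esub>j\<in>I \<times> {..<degree f}. ?a j \<odot>\<^bsub>A\<^esub> monom_family b j) l" for l
    unfolding coeff_finsum_monom_family using v by (auto simp: coeff_eq_0 simp flip: c(2))
  then show "\<exists>a\<in>I \<times> {..<degree f} \<rightarrow> carrier F.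
      v = (\<Oplus>\<^bsub>A\<^esub>j\<in>I \<times> {..<degree f}. a j \<odot>\<^bsub>A\<^esub> monom_family b j)"
    using c(1) by (intro bexI[of _ ?a] poly_eqI) auto
qed

lemma dim_petit_if_basis:
  assumes "basis_over_constants I b"
  shows "petit.fin_dim" and "petit.dim = card I * degree f"
proof -
  have fin: "finite (I \<times> {..<degree f})"
    using assms by (simp add: basis_over_constants_def)
  show "petit.fin_dim" "petit.dim = card I * degree f"
    using petit.dim_if_basis_family[OF fin monom_family_closed lin_indpt_monom_family[OF assms]
        spanning_monom_family[OF assms]]
    by (simp_all add: card_cartesian_product)
qed


subsection \<open>Division algebras\<close>

lemma unital_division_algebra_if_dirreducible:
  assumes "dirreducible f" "petit.fin_dim"
  shows "unital_division_algebra F A"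
  using assms(2)
proof (rule petit.unital_division_algebra_if_no_zero_divisors)
  fix x y assume xy: "x \<in> carrier A" "y \<in> carrier A" "x \<otimes>\<^bsub>A\<^esub> y = \<zero>\<^bsub>A\<^esub>"
  obtain q where "x \<bullet> y = q \<bullet> f"
    using mod_r_division[OF f_nonzero, of "x \<bullet> y"] xy(3) by force
  then show "x = \<zero>\<^bsub>A\<^esub> \<or> y = \<zero>\<^bsub>A\<^esub>"
    using dirreducible_degree_le[OF assms(1)] xy(1,2) by force
qed simp


subsection \<open>Nuclei\<close>

lemma associator_petit:
  assumes "x \<in> carrier A" "y \<in> carrier A" "z \<in> carrier A"
    and q: "x \<bullet> y = q \<bullet> f + mod_r \<delta> (x \<bullet> y) f"
  shows "associator A x y z = - mod_r \<delta> (q \<bullet> (f \<bullet> z)) f"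
proof -
  have "mod_r \<delta> (x \<bullet> y) f \<bullet> z = x \<bullet> y \<bullet> z - q \<bullet> (f \<bullet> z)"
    using q by (metis add_diff_cancel_left' dmult_assoc dmult_left.diff)
  then have "(x \<otimes>\<^bsub>A\<^esub> y) \<otimes>\<^bsub>A\<^esub> z = mod_r \<delta> (x \<bullet> y \<bullet> z) f - mod_r \<delta> (q \<bullet> (f \<bullet> z)) f"
    by (simp add: mod_r.diff)
  moreover have "x \<otimes>\<^bsub>A\<^esub> (y \<otimes>\<^bsub>A\<^esub> z) = mod_r \<delta> (x \<bullet> y \<bullet> z) f"
    by (simp add: mod_r_dmult_mod_r dmult_assoc)
  moreover have "x \<otimes>\<^bsub>A\<^esub> (y \<otimes>\<^bsub>A\<^esub> z) \<in> carrier A"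
    by (simp add: degree_mod_r)
  ultimately show ?thesis
    unfolding associator_def by (simp only: minus_petit) simp
qed

lemma associator_eq_0_if_degree_less:
  assumes "x \<in> carrier A" "y \<in> carrier A" "z \<in> carrier A" "degree x + degree y < degree f"
  shows "associator A x y z = 0"
  using associator_petit[OF assms(1-3), of 0] le_less_trans[OF degree_dmult_le assms(4)]
  by (simp add: mod_r_small mod_r.zero)

lemma associator_neq_0_if_degree_eq:
  assumes "x \<in> carrier A" "y \<in> carrier A" "z \<in> carrier A"
    and degree: "degree x + degree y = degree f" and z: "mod_r \<delta> (f \<bullet> z) f \<noteq> 0"
  shows "associator A x y z \<noteq> 0"
proof -
  obtain q where q: "x \<bullet> y = q \<bullet> f + mod_r \<delta> (x \<bullet> y) f"
    using mod_r_division[OF f_nonzero] .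
  have "x \<noteq> 0" "y \<noteq> 0"
    using assms by auto
  then have degree_xy: "degree (x \<bullet> y) = degree f"
    using degree by (simp add: degree_dmult)
  then have "q \<noteq> 0"
    using q degree_mod_r[of "x \<bullet> y"] by auto
  moreover have "degree (q \<bullet> f) \<le> degree f"
    using q degree_mod_r[of "x \<bullet> y"] degree_xy
      degree_diff_le[of "x \<bullet> y" "degree f" "mod_r \<delta> (x \<bullet> y) f"]
    by (metis add_diff_cancel_right' less_imp_le order.refl)
  ultimately have "degree q = 0"
    by (simp add: degree_dmult)
  then obtain a where a: "q = [:a:]" "a \<noteq> 0"
    using \<open>q \<noteq> 0\<close> degree_eq_zeroE by (metis pCons_0_0)
  then show ?thesis
    using associator_petit[OF assms(1-3) q] z by (simp add: dmult_const_left mod_r_smult)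
qed

lemma constant_polys_iff: "x \<in> constant_polys \<longleftrightarrow> degree x = 0"
  by (auto simp: constant_polys_def elim: degree_eq_zeroE)

lemma not_right_invariantE:
  assumes "\<not> right_invariant f"
  obtains z where "z \<in> carrier A" "mod_r \<delta> (f \<bullet> z) f \<noteq> 0"
proof -
  obtain z where "mod_r \<delta> (f \<bullet> z) f \<noteq> 0"
    using assms by (auto simp: right_invariant_def)
  then show thesis
    using that[of "mod_r \<delta> z f"] by (simp add: degree_mod_r mod_r_dmult_mod_r)
qed

lemma left_nucleus_if_not_right_invariant:
  assumes "\<not> right_invariant f"
  shows "left_nucleus A = constant_polys"
proof (rule Set.set_eqI)
  fix x
  obtain z where z: "z \<in> carrier A" "mod_r \<delta> (f \<bullet> z) f \<noteq> 0"
    using assms by (rule not_right_invariantE)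
  have "degree x = 0" if "x \<in> left_nucleus A"
    using that associator_neq_0_if_degree_eq[of x "Polynomial.monom 1 (degree f - degree x)" z]
      z degree_pos
    by (cases "degree x = 0") (auto simp: left_nucleus_def degree_monom_eq)
  moreover have "x \<in> left_nucleus A" if "degree x = 0"
    using that degree_pos by (auto simp: left_nucleus_def associator_eq_0_if_degree_less)
  ultimately show "x \<in> left_nucleus A \<longleftrightarrow> x \<in> constant_polys"
    by (auto simp: constant_polys_iff)
qed

lemma middle_nucleus_if_not_right_invariant:
  assumes "\<not> right_invariant f"
  shows "middle_nucleus A = constant_polys"
proof (rule Set.set_eqI)
  fix y
  obtain z where z: "z \<in> carrier A" "mod_r \<delta> (f \<bullet> z) f \<noteq> 0"
    using assms by (rule not_right_invariantE)
  have "degree y = 0" if "y \<in> middle_nucleus A"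
    using that associator_neq_0_if_degree_eq[of "Polynomial.monom 1 (degree f - degree y)" y z]
      z degree_pos
    by (cases "degree y = 0") (auto simp: middle_nucleus_def degree_monom_eq)
  moreover have "y \<in> middle_nucleus A" if "degree y = 0"
    using that degree_pos by (auto simp: middle_nucleus_def associator_eq_0_if_degree_less)
  ultimately show "y \<in> middle_nucleus A \<longleftrightarrow> y \<in> constant_polys"
    by (auto simp: constant_polys_iff)
qed

lemma right_nucleus_petit:
  assumes "z \<in> carrier A" "f \<bullet> z = h \<bullet> f"
  shows "z \<in> right_nucleus A"
proof -
  have "associator A x y z = 0" if "x \<in> carrier A" "y \<in> carrier A" for x y
  proof -
    obtain q where "x \<bullet> y = q \<bullet> f + mod_r \<delta> (x \<bullet> y) f"
      using mod_r_division[OF f_nonzero] .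
    then show ?thesis
      using associator_petit[OF that assms(1)] assms(2)
      by (simp add: mod_r_dmult_self flip: dmult_assoc)
  qed
  then show ?thesis
    using assms(1) by (simp add: right_nucleus_def)
qed


subsection \<open>Automorphisms\<close>

abbreviation G :: "('a poly \<Rightarrow> 'a poly) monoid" where "G \<equiv> Algebra_AutoGroup F A"

sublocale auto_group: group G
  by (rule petit.group_Algebra_AutoGroup)

definition shift_auto :: "'a \<Rightarrow> 'a poly \<Rightarrow> 'a poly" where
  "shift_auto a = restrict (shift a) (carrier A)"

lemma shift_auto_Bij: "shift_auto a \<in> Bij (carrier A)"
proof -
  have "bij_betw (shift a) (carrier A) (carrier A)"
    by (rule bij_betw_byWitness[of _ "shift (- a)"]) (auto simp: shift_shift)
  then show ?thesis
    by (simp add: Bij_def shift_auto_def)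
qed

lemma shift_auto_closed:
  assumes "\<delta> a = 0" "shift a f = f"
  shows "shift_auto a \<in> carrier G"
proof -
  have "shift_auto a \<in> module_hom F A A"
    by (auto simp: module_hom_def shift_auto_def degree_add_less shift.add shift_smult
        intro: le_less_trans[OF degree_smult_le])
  moreover have "shift_auto a (x \<otimes>\<^bsub>A\<^esub> y) = shift_auto a x \<otimes>\<^bsub>A\<^esub> shift_auto a y"
    if "x \<in> carrier A" "y \<in> carrier A" for x y
    using that by (simp add: shift_auto_def degree_mod_r shift_mod_r shift_dmult assms)
  ultimately show ?thesis
    using shift_auto_Bij by (simp add: Algebra_AutoGroup_def algebra_auto_def)
qed

lemma shift_auto_mult: "shift_auto a \<otimes>\<^bsub>G\<^esub> shift_auto b = shift_auto (a + b)"
proof -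
  have "compose (carrier A) (shift_auto a) (shift_auto b) = shift_auto (a + b)"
    by (auto simp: fun_eq_iff compose_def shift_auto_def shift_shift)
  then show ?thesis
    using shift_auto_Bij by (simp add: Algebra_AutoGroup_def BijGroup_def)
qed

lemma shift_auto_0: "shift_auto 0 = \<one>\<^bsub>G\<^esub>"
  by (auto simp: Algebra_AutoGroup_def BijGroup_def shift_auto_def fun_eq_iff)

lemma shift_auto_pow: "shift_auto a [^]\<^bsub>G\<^esub> n = shift_auto (of_nat n * a)" for n :: nat
  by (induction n) (simp_all add: shift_auto_0 shift_auto_mult algebra_simps)

lemma shift_auto_eq_one_iff:
  assumes "degree f > 1"
  shows "shift_auto a = \<one>\<^bsub>G\<^esub> \<longleftrightarrow> a = 0"
proof
  assume "shift_auto a = \<one>\<^bsub>G\<^esub>"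
  then have "shift_auto a [:0, 1:] = shift_auto 0 [:0, 1:]"
    by (simp add: shift_auto_0)
  then show "a = 0"
    using assms by (simp add: shift_auto_def shift_pCons)
qed (simp add: shift_auto_0)

lemma shift_auto_const: "x \<in> constant_polys \<Longrightarrow> shift_auto a x = x"
  using degree_pos by (auto simp: constant_polys_def shift_auto_def)

lemma ord_shift_auto:
  assumes "\<delta> a = 0" "shift a f = f" "a \<noteq> 0" "degree f > 1"
  shows "auto_group.ord (shift_auto a) = CHAR('a)"
  using assms
  by (simp add: auto_group.ord_unique shift_auto_closed shift_auto_pow shift_auto_eq_one_iff
      of_nat_eq_0_iff_char_dvd)

lemma cyclic_automorphism_group:
  assumes "\<delta> a = 0" "shift a f = f" "a \<noteq> 0" "degree f > 1" "CHAR('a) > 0"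
  shows "\<exists>H. subgroup H G \<and> cyclic_group (G \<lparr>carrier := H\<rparr>) \<and> card H = CHAR('a) \<and>
    (\<forall>\<phi>\<in>H. \<forall>x\<in>constant_polys. \<phi> x = x)"
proof (intro exI conjI)
  note closed = shift_auto_closed[OF assms(1,2)] and ord = ord_shift_auto[OF assms(1-4)]
  let ?H = "generate G {shift_auto a}"
  show "subgroup ?H G"
    using closed by (intro auto_group.generate_is_subgroup) simp
  show "cyclic_group (G \<lparr>carrier := ?H\<rparr>)"
    using auto_group.cyclic_group_generated[of "shift_auto a"] closed
    by (simp add: subgroup_generated_def)
  show "card ?H = CHAR('a)"
    using auto_group.generate_pow_card[OF closed] ord by simp
  show "\<forall>\<phi>\<in>?H. \<forall>x\<in>constant_polys. \<phi> x = x"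
    using auto_group.generate_pow_nat[OF closed] ord assms(5) shift_auto_const
    by (auto simp: shift_auto_pow)
qed

end


section \<open>The algebras \<open>(K, \<delta>, d)\<close>\<close>

locale artin_schreier_petit = differential_field \<delta> for \<delta> :: "'a::field \<Rightarrow> 'a" +
  fixes d :: 'a
  assumes CHAR_pos: "CHAR('a) > 0"
    and minpoly: "is_minimum_polynomial \<delta> (artin_schreier_poly CHAR('a))"
    and delta_d: "\<delta> d \<noteq> 0"
begin

lemma prime_CHAR: "prime CHAR('a)"
  using CHAR_pos by (rule prime_CHAR_semidom)

lemma CHAR_gt_1: "CHAR('a) > 1"
  using prime_CHAR prime_gt_1_nat by blast

abbreviation f :: "'a poly" where "f \<equiv> artin_schreier_poly CHAR('a) - [:d:]"

lemma degree_f: "degree f = CHAR('a)"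
  using degree_artin_schreier_poly[OF CHAR_gt_1] CHAR_pos degree_add_eq_left[of "- [:d:]"]
  by (metis degree_minus degree_pCons_0 diff_conv_add_uminus)

sublocale petit \<delta> f
  by unfold_locales (simp add: degree_f CHAR_pos)

lemma dcentral_artin_schreier: "dcentral (artin_schreier_poly CHAR('a))"
  using dcentral_artin_schreier_poly prime_CHAR minpoly by (simp add: is_minimum_polynomial_def)

lemma f_dmult: "f \<bullet> z = z \<bullet> f + (z \<bullet> [:d:] - Polynomial.smult d z)"
  using dcentral_artin_schreier by (rule dcentral_diff_const_dmult)

lemma fin_dim_petit: "petit.fin_dim"
  and dim_petit: "petit.dim = CHAR('a) ^ 2"
proof -
  obtain u where "basis_over_constants {..<CHAR('a)} (\<lambda>i. u ^ i)"
    using artin_schreier_basis[OF minpoly CHAR_pos] .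
  from dim_petit_if_basis[OF this] show "petit.fin_dim" "petit.dim = CHAR('a) ^ 2"
    by (simp_all add: degree_f power2_eq_square)
qed

lemma unital_division_algebra_petit: "unital_division_algebra F A"
  using dcentral_artin_schreier degree_artin_schreier_poly[OF CHAR_gt_1] CHAR_pos delta_d
    fin_dim_petit
  by (intro unital_division_algebra_if_dirreducible dirreducible_dcentral_diff_const)

lemma not_right_invariant_f: "\<not> right_invariant f"
proof -
  have "f \<bullet> [:0, 1:] = [:0, 1:] \<bullet> f + [:\<delta> d:]"
    unfolding f_dmult by (simp add: dmult_pCons t_mult_def map_poly_pCons)
  then have "mod_r \<delta> (f \<bullet> [:0, 1:]) f = [:\<delta> d:]"
    by (rule mod_r_eqI) (simp add: degree_f CHAR_pos)
  then show ?thesis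
    using delta_d by (metis pCons_eq_0_iff right_invariant_def)
qed

lemma constant_polys_subset_right_nucleus: "constant_polys \<subseteq> right_nucleus A"
proof
  fix z :: "'a poly" assume "z \<in> constant_polys"
  then obtain a where "z = [:a:]"
    by (auto simp: constant_polys_def)
  then show "z \<in> right_nucleus A"
    using f_dmult[of z] degree_pos
    by (intro right_nucleus_petit[where h = z]) (simp_all add: dmult_const_left)
qed

lemma shift_f: "shift 1 f = f"
  using pcompose_artin_schreier_poly[OF prime_CHAR] by (simp add: shift_def pcompose_diff)

end

theorem theorem14:
  fixes \<delta> :: "'a::field \<Rightarrow> 'a" and p :: nat and d :: 'a and f :: "'a poly"
  assumes "CHAR('a) = p" and "p > 0"
    and "derivation \<delta>"
    and "is_minimum_polynomial \<delta> (Polynomial.monom 1 p - Polynomial.monom 1 1)"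
    and "d \<notin> constants \<delta>"
    and "f = Polynomial.monom 1 p - Polynomial.monom 1 1 - [:d:]"
  shows "unital_division_algebra (constant_field \<delta>) (petit_algebra \<delta> f) \<and>
    vectorspace.fin_dim (constant_field \<delta>) (petit_algebra \<delta> f) \<and>
    vectorspace.dim (constant_field \<delta>) (petit_algebra \<delta> f) = p ^ 2 \<and>
    left_nucleus (petit_algebra \<delta> f) = constant_polys \<and>
    middle_nucleus (petit_algebra \<delta> f) = constant_polys \<and>
    constant_polys \<subseteq> right_nucleus (petit_algebra \<delta> f) \<and>
    (\<exists>H. subgroup H (Algebra_AutoGroup (constant_field \<delta>) (petit_algebra \<delta> f)) \<and>
       cyclic_group
         ((Algebra_AutoGroup (constant_field \<delta>) (petit_algebra \<delta> f)) \<lparr>carrier := H\<rparr>) \<and>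
       card H = p \<and>
       (\<forall>\<phi> \<in> H. \<forall>x \<in> constant_polys. \<phi> x = x))"
proof -
  interpret artin_schreier_petit \<delta> d
    using assms(1-5) by unfold_locales (auto simp: constants_def artin_schreier_poly_def)
  have f: "f = artin_schreier_poly CHAR('a) - [:d:]"
    using assms(1,6) by (simp add: artin_schreier_poly_def)
  have "degree f > 1"
    using CHAR_gt_1 by (simp add: f degree_f)
  then have "\<exists>H. subgroup H G \<and> cyclic_group (G \<lparr>carrier := H\<rparr>) \<and> card H = CHAR('a) \<and>
      (\<forall>\<phi>\<in>H. \<forall>x\<in>constant_polys. \<phi> x = x)"
    using cyclic_automorphism_group[OF delta_one shift_f] CHAR_pos by (simp add: f)
  then show ?thesis
    unfolding f assms(1)[symmetric]
    by (intro conjI unital_division_algebra_petit fin_dim_petit dim_petit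
        left_nucleus_if_not_right_invariant middle_nucleus_if_not_right_invariant
        not_right_invariant_f constant_polys_subset_right_nucleus)
qed

end
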